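(* Assume that for every $s\in\mathbb N$: (i) $(x,a)\mapsto P(s,x,a,\cdot)$ is weakly continuous, i.e. $\int f\,dP(s,x^n,a^n,\cdot)\to\int f\,dP(s,x^0,a^0,\cdot)$ for all $f\in C_b(\mathbb X)$ whenever $x^n\to x^0$ in $\mathbb X$ and $a^n\to a^0$ in $\mathbb A$; (ii) $\bigcup_{x\in\mathbb X}\mathcal A_s(x)$ is compact and $\mathcal A_s$ is upper hemi-continuous (for every $x$ and every open $U_{\mathbb A}\supseteq\mathcal A_s(x)$ there is an open $U_{\mathbb X}\ni x$ with $\mathcal A_s(z)\subseteq U_{\mathbb A}$ for all $z\in U_{\mathbb X}$); (iii) for every compact $K\subset\mathbb R$, every $(\mu^n)_{n\in\mathbb N}\subset\mathcal P(K)$ converging weakly to $\mu^0\in\mathcal P(K)$ and every $x^n\to x^0$ in $\mathbb X$, $\liminf_{n\to\infty}\sigma_{s,x^n}(\mu^n)\ge\sigma_{s,x^0}(\mu^0)$; (iv) $C_s$ is lower semi-continuous and $\|C_s\|_\infty\le b$, where $b>0$ does not depend on $s$. Let $t\in\mathbb N$ and suppose that for all $\mu_1,\mu_2\in\mathcal P_b(\mathbb R)$ and $\theta\in[0,1]$, $$\sigma_{t,x}(\theta\mu_1+(1-\theta)\mu_2)\ge\min\{\sigma_{t,x}(\mu_1),\sigma_{t,x}(\mu_2)\},\qquad x\in\mathbb X.$$ Then for every $T\in\mathbb N$ with $T>t$ there is a measurable $\pi^\delta_t:(\mathbb X,\mathcal B(\mathbb X))\to(\Lambda,\mathcal E(\Lambda))$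 such that, for all $x\in\mathbb X$, $\pi^\delta_t(x)$ is a Dirac measure and $$\pi^\delta_t(x)\in\arg\min_{\lambda\in\varpi_t(x)}G^\lambda_tJ^*_{t+1,T}(x).$$ If, in addition, $\gamma\in(0,1)$ and $(\sigma_{s,x})_{(s,x)\in\mathbb N\times\mathbb X}$ is normalized (i.e. $\sigma_{s,x}(\delta_0)=0$ for all $(s,x)\in\mathbb N\times\mathbb X$), then the same holds for $T=\infty$.
   Context: Spaces. $\mathbb N=\{1,2,\dots\}$. $\mathbb X$ (states) and $\mathbb A$ (actions) are complete separable metric spaces with Borel $\sigma$-algebras. $\Lambda$ is the set of Borel probability measures on $\mathbb A$ with the weak topology; its Borel $\sigma$-algebra equals $\mathcal E(\Lambda)$, the $\sigma$-algebra generated by the maps $\lambda\mapsto\lambda(B)$, $B\in\mathcal B(\mathbb A)$. $\ell^\infty(\mathbb X,\mathcal B(\mathbb X))$ is the space of bounded Borel functions with sup norm; $O\equiv0$ on $\mathbb X$. For closed $F\subseteq\mathbb R$, $\mathcal P(F)$ is the set of Borel probability measures on $F$ with the weak topology; $\mathcal P_b(\mathbb R)$, $\mathcal P_b(\mathbb R^2)$ are the Borel probability measures with bounded support. $\gamma\in[0,1]$ is a fixed discount factor. Risk measures. A law-invariant convex risk measure (at the level of distributions) is a map $\sigma:\mathcal P_b(\mathbb R)\to(-\infty,\infty]$ with: (1) $\sigma(\mu*\delta_c)=\sigma(\mu)+c$ for $c\in\mathbb R$; (2) $\mu((-\infty,r])\ge\mu'((-\infty,r])$ for all $r$ implies $\sigma(\mu)\le\sigma(\mu')$;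 (3) for $\zeta\in\mathcal P_b(\mathbb R^2)$ with first and second marginals $\zeta_0,\zeta_1$, and $\theta\in[0,1]$, if $\zeta_\theta$ is the image of $\zeta$ under $(r_0,r_1)\mapsto(1-\theta)r_0+\theta r_1$, then $\sigma(\zeta_\theta)\le(1-\theta)\sigma(\zeta_0)+\theta\sigma(\zeta_1)$. Fix such $(\sigma_{t,x})_{(t,x)\in\mathbb N\times\mathbb X}$; it is assumed that for every $t$ and compact $K\subset\mathbb R$, $(x,\mu)\mapsto\sigma_{t,x}(\mu)$ is Borel measurable on $\mathbb X\times\mathcal P(K)$, and that $|\sigma_{t,x}(\delta_0)|\le b_t$ for all $x$, for some $b_t\ge0$. Actions, kernel, costs. For $t\in\mathbb N$, $\mathcal A_t:\mathbb X\to2^{\mathbb A}$ is nonempty closed-valued and weakly measurable ($\{x:\mathcal A_t(x)\cap U\ne\emptyset\}\in\mathcal B(\mathbb X)$ for open $U$); $\varpi_t(x):=\{\lambda\in\Lambda:\lambda(\mathcal A_t(x))=1\}$. $P$ is a transition kernel: $P(t,x,a,\cdot)$ is a Borel probability on $\mathbb X$ and $(x,a)\mapsto P(t,x,a,B)$ is measurable for each $t$ and $B\in\mathcal B(\mathbb X)$. $C_t:\mathbb X\times\mathbb A\times\mathbb X\to\mathbb R$ is Borel measurable. Operators and value functions. For $v\in\ell^\infty(\mathbb X,\mathcal B(\mathbb X))$, $\lambda\in\Lambda$: $\widetilde P^v_{t,x,\lambda}(B):=\int_{\mathbb A}\int_{\mathbb X}1_B(C_t(x,a,y)+\gamma v(y))\,P(t,x,a,dy)\,\lambda(da)$,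 $B\in\mathcal B(\mathbb R)$; $G^\lambda_tv(x):=\sigma_{t,x}(\widetilde P^v_{t,x,\lambda})$; $S_tv(x):=\inf_{\lambda\in\varpi_t(x)}G^\lambda_tv(x)$. For $t,T\in\mathbb N$: $J^*_{t,T}:=O$ if $t>T$, $J^*_{t,T}:=S_tJ^*_{t+1,T}$ if $t\le T$ (bounded and Borel under (i)–(iv)). When $\gamma<1$ and $(\sigma_{t,x})$ is normalized, $J^*_{t,\infty}:=\lim_{T\to\infty}J^*_{t,T}$ (the limit exists, uniformly on $\mathbb X$). *)

theory Defs
  imports "HOL-Probability.Probability"
begin

subsection \<open>Spaces of probability measures\<close>

text \<open>
  A probability measure on a closed set \<open>F\<close> is represented by a Borel probability measure on the
  ambient space that gives \<open>F\<close> full mass. The measurable space \<open>\<Lambda>\<close> with the sigma-algebra generated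
  by the evaluation maps is \<^term>\<open>prob_algebra borel\<close>.
\<close>

definition probs_on :: "'a::topological_space set \<Rightarrow> 'a measure set" where
  "probs_on F = {\<mu> \<in> space (prob_algebra borel). measure \<mu> F = 1}"

text \<open>The support of \<open>\<mu>\<close> is the least closed set of full mass, so it is bounded iff some closed
  bounded set has full mass.\<close>

definition bdd_probs :: "'a::metric_space measure set" where
  "bdd_probs = {\<mu>. \<exists>F. closed F \<and> bounded F \<and> \<mu> \<in> probs_on F}"

text \<open>The coarsest topology on \<^term>\<open>probs_on F\<close> that makes integration of every bounded continuous
  function on \<open>F\<close> continuous.\<close>

definition weak_topology :: "'a::topological_space set \<Rightarrow> 'a measure topology" where
  "weak_topology F = topology_generated_by
     {{\<mu> \<in> probs_on F. (LINT z:F|\<mu>. f z) \<in> U} | (f :: 'a \<Rightarrow> real) U.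
        continuous_on F f \<and> bounded (f ` F) \<and> open U}"

definition borel_of :: "'a topology \<Rightarrow> 'a measure" where
  "borel_of T = sigma (topspace T) {U. openin T U}"

text \<open>The convex combination \<open>\<theta> \<mu>\<^sub>1 + (1 - \<theta>) \<mu>\<^sub>2\<close> of measures.\<close>

definition mixture ::
    "real \<Rightarrow> 'a::topological_space measure \<Rightarrow> 'a measure \<Rightarrow> 'a measure" where
  "mixture \<theta> \<mu>1 \<mu>2 = measure_of UNIV (sets borel)
     (\<lambda>B. ennreal \<theta> * emeasure \<mu>1 B + ennreal (1 - \<theta>) * emeasure \<mu>2 B)"


subsection \<open>Semicontinuity and correspondences\<close>

definition lower_semicontinuous :: "('a::topological_space \<Rightarrow> real) \<Rightarrow> bool" where
  "lower_semicontinuous f \<longleftrightarrow> (\<forall>z. \<forall>c < f z. \<forall>\<^sub>F w in nhds z. c < f w)"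

definition weakly_measurable ::
    "('x::topological_space \<Rightarrow> 'a::topological_space set) \<Rightarrow> bool" where
  "weakly_measurable \<Phi> \<longleftrightarrow> (\<forall>U. open U \<longrightarrow> {x. \<Phi> x \<inter> U \<noteq> {}} \<in> sets borel)"

definition upper_hemicontinuous ::
    "('x::topological_space \<Rightarrow> 'a::topological_space set) \<Rightarrow> bool" where
  "upper_hemicontinuous \<Phi> \<longleftrightarrow>
     (\<forall>x U. open U \<and> \<Phi> x \<subseteq> U \<longrightarrow> (\<exists>V. open V \<and> x \<in> V \<and> (\<forall>z\<in>V. \<Phi> z \<subseteq> U)))"


subsection \<open>Law-invariant convex risk measures\<close>

text \<open>A map from \<^term>\<open>bdd_probs :: real measure set\<close> to \<open>(-\<infinity>, \<infinity>]\<close> is represented by a total function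
  into \<^typ>\<open>ereal\<close>; its values off \<^const>\<open>bdd_probs\<close> are irrelevant.\<close>

definition convex_risk_measure :: "(real measure \<Rightarrow> ereal) \<Rightarrow> bool" where
  "convex_risk_measure \<sigma> \<longleftrightarrow>
     (\<forall>\<mu>\<in>bdd_probs. \<sigma> \<mu> \<noteq> -\<infinity>) \<and>
     (\<forall>\<mu>\<in>bdd_probs. \<forall>c. \<sigma> (convolution \<mu> (return borel c)) = \<sigma> \<mu> + ereal c) \<and>
     (\<forall>\<mu>\<in>bdd_probs. \<forall>\<mu>'\<in>bdd_probs.
        (\<forall>r. measure \<mu> {..r} \<ge> measure \<mu>' {..r}) \<longrightarrow> \<sigma> \<mu> \<le> \<sigma> \<mu>') \<and>
     (\<forall>\<zeta>\<in>(bdd_probs :: (real \<times> real) measure set). \<forall>\<theta>\<in>{0..1}.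
        \<sigma> (distr \<zeta> borel (\<lambda>(r0, r1). (1 - \<theta>) * r0 + \<theta> * r1))
          \<le> ereal (1 - \<theta>) * \<sigma> (distr \<zeta> borel fst) + ereal \<theta> * \<sigma> (distr \<zeta> borel snd))"


subsection \<open>Operators and value functions\<close>

text \<open>Time indices are natural numbers; only indices \<open>\<ge> 1\<close> are meaningful.\<close>

type_synonym ('x, 'a) kernel = "nat \<Rightarrow> 'x \<Rightarrow> 'a \<Rightarrow> 'x measure"
type_synonym ('x, 'a) cost = "nat \<Rightarrow> 'x \<Rightarrow> 'a \<Rightarrow> 'x \<Rightarrow> real"
type_synonym 'x risk = "nat \<Rightarrow> 'x \<Rightarrow> real measure \<Rightarrow> ereal"

definition cost_law ::
    "real \<Rightarrow> ('x, 'a) kernel \<Rightarrow> ('x, 'a) cost \<Rightarrow> ('x \<Rightarrow> real) \<Rightarrow> nat \<Rightarrow> 'x \<Rightarrow> 'a measure \<Rightarrow> real measure"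
  where
  "cost_law \<gamma> P C v t x \<Lambda> = measure_of UNIV (sets borel)
     (\<lambda>B. \<integral>\<^sup>+a. (\<integral>\<^sup>+y. indicator B (C t x a y + \<gamma> * v y) \<partial>P t x a) \<partial>\<Lambda>)"

definition G_op ::
    "real \<Rightarrow> 'x risk \<Rightarrow> ('x, 'a) kernel \<Rightarrow> ('x, 'a) cost \<Rightarrow> nat \<Rightarrow> 'a measure \<Rightarrow> ('x \<Rightarrow> real) \<Rightarrow> 'x \<Rightarrow> ereal"
  where
  "G_op \<gamma> \<sigma> P C t \<Lambda> v x = \<sigma> t x (cost_law \<gamma> P C v t x \<Lambda>)"

definition S_op ::
    "real \<Rightarrow> 'x risk \<Rightarrow> (nat \<Rightarrow> 'x \<Rightarrow> 'a::topological_space set) \<Rightarrow> ('x, 'a) kernel \<Rightarrow> ('x, 'a) cost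
      \<Rightarrow> nat \<Rightarrow> ('x \<Rightarrow> real) \<Rightarrow> 'x \<Rightarrow> ereal"
  where
  "S_op \<gamma> \<sigma> A P C t v x = (INF \<Lambda>\<in>probs_on (A t x). G_op \<gamma> \<sigma> P C t \<Lambda> v x)"

text \<open>The coercion \<^const>\<open>real_of_ereal\<close> is harmless: under the standing assumptions \<^const>\<open>S_op\<close> maps
  bounded functions to finite values.\<close>

function J_opt ::
    "real \<Rightarrow> 'x risk \<Rightarrow> (nat \<Rightarrow> 'x \<Rightarrow> 'a::topological_space set) \<Rightarrow> ('x, 'a) kernel \<Rightarrow> ('x, 'a) cost
      \<Rightarrow> nat \<Rightarrow> nat \<Rightarrow> 'x \<Rightarrow> real"
  where
  "J_opt \<gamma> \<sigma> A P C t T =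
     (if t > T then (\<lambda>x. 0)
      else (\<lambda>x. real_of_ereal (S_op \<gamma> \<sigma> A P C t (J_opt \<gamma> \<sigma> A P C (t + 1) T) x)))"
  by auto
termination
  by (relation "Wellfounded.measure (\<lambda>(\<gamma>, \<sigma>, A, P, C, t, T). T + 1 - t)") auto

declare J_opt.simps [simp del]

text \<open>Meaningful only when the limit exists, as it does for \<open>\<gamma> < 1\<close> and normalized risk measures.\<close>

definition J_opt_inf ::
    "real \<Rightarrow> 'x risk \<Rightarrow> (nat \<Rightarrow> 'x \<Rightarrow> 'a::topological_space set) \<Rightarrow> ('x, 'a) kernel \<Rightarrow> ('x, 'a) cost
      \<Rightarrow> nat \<Rightarrow> 'x \<Rightarrow> real"
  where
  "J_opt_inf \<gamma> \<sigma> A P C t x = lim (\<lambda>T. J_opt \<gamma> \<sigma> A P C t T x)"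

text \<open>A measurable selector of Dirac minimizers of \<open>\<Lambda> \<mapsto> G\<^sub>t\<^sup>\<Lambda> v (x)\<close> over the admissible
  randomized actions.\<close>

definition optimal_dirac_policy ::
    "real \<Rightarrow> 'x::topological_space risk \<Rightarrow> (nat \<Rightarrow> 'x \<Rightarrow> 'a::topological_space set) \<Rightarrow> ('x, 'a) kernel
      \<Rightarrow> ('x, 'a) cost \<Rightarrow> nat \<Rightarrow> ('x \<Rightarrow> real) \<Rightarrow> ('x \<Rightarrow> 'a measure) \<Rightarrow> bool"
  where
  "optimal_dirac_policy \<gamma> \<sigma> A P C t v \<pi> \<longleftrightarrow>
     \<pi> \<in> borel \<rightarrow>\<^sub>M prob_algebra borel \<and>
     (\<forall>x. (\<exists>a. \<pi> x = return borel a) \<and>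
          is_arg_min (\<lambda>\<Lambda>. G_op \<gamma> \<sigma> P C t \<Lambda> v x) (\<lambda>\<Lambda>. \<Lambda> \<in> probs_on (A t x)) (\<pi> x))"

end

theory Submission
  imports Defs
begin

text \<open>
  The argument has two halves: the value functions are lower semicontinuous, and a lower
  semicontinuous continuation value admits a measurable selector of optimal Dirac actions.

  For a bounded lower semicontinuous \<open>v\<close> the total cost \<open>C + \<gamma> v\<close> is lower semicontinuous. If
  \<open>x\<^sub>n \<longlonglongrightarrow> x\<^sub>0\<close> and the randomized actions \<open>\<Lambda>\<^sub>n\<close> converge weakly to \<open>\<Lambda>\<^sub>0\<close>, then any weak limit \<open>\<mu>\<close> of the
  cost distributions stochastically dominates the cost distribution at \<open>(x\<^sub>0, \<Lambda>\<^sub>0)\<close>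
  (\<open>weakly_converges_Fatou\<close>, \<open>law_Fatou\<close>). Such limits exist along subsequences by Helly's theorem,
  since all these distributions live on one compact interval; semicontinuity of the risk
  measure along the subsequence and its monotonicity then show that the risk is jointly lower
  semicontinuous in the state and the randomized action (\<open>risk_of_sublevel_closed\<close>).

  At the times after \<open>t\<close> nothing forbids genuine randomization, so lower semicontinuity of the
  optimal value needs weak compactness of the admissible randomized actions: Prokhorov's theorem on
  a compact set, obtained from Helly's theorem by coding points as real numbers
  (\<open>Prokhorov_probs_on\<close>, \<open>optimal_value_lsc\<close>). Backward induction gives the finite horizon; for the
  infinite horizon the Bellman operator contracts with factor \<open>\<gamma>\<close>, so that the value functions
  converge uniformly and the limit inherits lower semicontinuity (\<open>J_opt_inf_lsc_bounded\<close>).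

  At time \<open>t\<close> quasiconcavity makes randomization useless. If every admissible Dirac action has risk
  above a level, lower semicontinuity keeps the risk above this level for all distributions
  concentrated near one action; splitting a randomized action along a finite cover of the compact
  action set by such neighbourhoods exhibits it as an iterated mixture of distributions of
  this kind (\<open>randomization_no_gain\<close>). It remains to minimize a jointly lower semicontinuous function
  over a compact-valued correspondence with closed graph, measurably in the state. Minimizing
  successively the distances to a dense sequence of points singles out one minimizer
  (\<open>measurable_argmin_selector\<close>).
\<close>

section \<open>Lower semicontinuity\<close>

text \<open>
  Closed sublevel sets are the form in which semicontinuity is used throughout: such a statement can
  be checked along sequences and passes to subsequences, unlike a bound on a lower limit.
\<close>

lemma lower_semicontinuous_iff_closed_sublevel:
  "lower_semicontinuous f \<longleftrightarrow> (\<forall>c. closed {w. f w \<le> c})"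
proof -
  have "closed {w. f w \<le> c} \<longleftrightarrow> (\<forall>z. c < f z \<longrightarrow> (\<forall>\<^sub>F w in nhds z. c < f w))" for c
  proof -
    have "closed {w. f w \<le> c} \<longleftrightarrow> open {w. c < f w}"
      unfolding closed_def by (rule arg_cong[where f = "open"]) auto
    also have "\<dots> \<longleftrightarrow> (\<forall>z\<in>{w. c < f w}. \<exists>T. open T \<and> z \<in> T \<and> T \<subseteq> {w. c < f w})"
      by (rule open_subopen)
    also have "\<dots> \<longleftrightarrow> (\<forall>z. c < f z \<longrightarrow> (\<forall>\<^sub>F w in nhds z. c < f w))"
      by (auto simp: eventually_nhds subset_iff Ball_def)
    finally show ?thesis .
  qed
  then show ?thesis
    unfolding lower_semicontinuous_def by blast
qed

lemma lower_semicontinuous_borel_measurable: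
  assumes "lower_semicontinuous f"
  shows "f \<in> borel_measurable borel"
  using assms unfolding borel_measurable_iff_le lower_semicontinuous_iff_closed_sublevel
  by auto

lemma lower_semicontinuous_compose_mono:
  fixes h :: "real \<Rightarrow> real"
  assumes f: "lower_semicontinuous f" and h: "mono h" "continuous_on UNIV h"
  shows "lower_semicontinuous (\<lambda>w. h (f w))"
  unfolding lower_semicontinuous_def
proof (intro allI impI)
  fix z c assume c: "c < h (f z)"
  have "(h \<longlongrightarrow> h (f z)) (at (f z))"
    using h(2) by (simp add: continuous_on_def)
  then have "\<forall>\<^sub>F r in at (f z). c < h r"
    using c order_tendstoD(1) by blast
  then obtain d where d: "d > 0" "\<And>r. r \<noteq> f z \<Longrightarrow> dist r (f z) < d \<Longrightarrow> c < h r"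
    unfolding eventually_at by auto
  have r: "c < h (f z - d / 2)"
    using d by (intro d(2)) (auto simp: dist_real_def)
  have "\<forall>\<^sub>F w in nhds z. f z - d / 2 < f w"
    using f d(1) unfolding lower_semicontinuous_def by auto
  then show "\<forall>\<^sub>F w in nhds z. c < h (f w)"
  proof eventually_elim
    case (elim w)
    then have "h (f z - d / 2) \<le> h (f w)"
      by (intro monoD[OF h(1)]) simp
    then show ?case using r by simp
  qed
qed

lemma lower_semicontinuous_add:
  assumes f: "lower_semicontinuous f" and g: "lower_semicontinuous g"
  shows "lower_semicontinuous (\<lambda>w. f w + g w)"
  unfolding lower_semicontinuous_def
proof (intro allI impI)
  fix z c assume c: "c < f z + g z"
  define d where "d = (f z + g z - c) / 2"
  have "\<forall>\<^sub>F w in nhds z. f z - d < f w" "\<forall>\<^sub>F w in nhds z. g z - d < g w"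
    using f g c unfolding lower_semicontinuous_def by (auto simp: d_def)
  then show "\<forall>\<^sub>F w in nhds z. c < f w + g w"
    by eventually_elim (simp add: d_def field_simps)
qed

lemma lower_semicontinuous_compose_continuous:
  assumes f: "lower_semicontinuous f" and h: "continuous_on UNIV h"
  shows "lower_semicontinuous (\<lambda>w. f (h w))"
  using assms closed_vimage[of "{w. f w \<le> c}" h for c]
  unfolding lower_semicontinuous_iff_closed_sublevel by (auto simp: vimage_def)

lemma lower_semicontinuous_indicator_Compl:
  assumes "closed F"
  shows "lower_semicontinuous (indicator (- F))"
proof -
  have "{w. indicator (- F) w \<le> c} = (if c < 0 then {} else if c < 1 then F else UNIV)" for c :: real
    by (auto simp: indicator_def)
  then show ?thesis
    using assms by (simp add: lower_semicontinuous_iff_closed_sublevel)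
qed

text \<open>
  The inf-convolution of \<open>f\<close> with \<open>k\<close> times the metric: if \<open>f\<close> is bounded below, this is
  the largest \<open>k\<close>-Lipschitz function below \<open>f\<close>.
\<close>

definition lipschitz_minorant :: "('w::metric_space \<Rightarrow> real) \<Rightarrow> nat \<Rightarrow> 'w \<Rightarrow> real" where
  "lipschitz_minorant f k w = (INF u. f u + real k * dist w u)"

context
  fixes f :: "'w::metric_space \<Rightarrow> real" and B :: real
  assumes bound: "\<And>w. \<bar>f w\<bar> \<le> B"
begin

lemma lipschitz_minorant_bdd_below: "bdd_below (range (\<lambda>u. f u + real k * dist w u))"
proof (rule bdd_belowI2[where m = "- B"])
  fix u
  have "0 \<le> real k * dist w u" by simp
  then show "- B \<le> f u + real k * dist w u" using bound[of u] by linarith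
qed

lemma lipschitz_minorant_le: "lipschitz_minorant f k w \<le> f u + real k * dist w u"
  unfolding lipschitz_minorant_def by (rule cINF_lower[OF lipschitz_minorant_bdd_below]) simp

lemma lipschitz_minorant_le_self: "lipschitz_minorant f k w \<le> f w"
  using lipschitz_minorant_le[of k w w] by simp

lemma lipschitz_minorant_ge: "(\<And>u. c \<le> f u + real k * dist w u) \<Longrightarrow> c \<le> lipschitz_minorant f k w"
  unfolding lipschitz_minorant_def by (rule cINF_greatest) auto

lemma abs_lipschitz_minorant_le: "\<bar>lipschitz_minorant f k w\<bar> \<le> B"
proof -
  have "- B \<le> lipschitz_minorant f k w"
  proof (rule lipschitz_minorant_ge)
    fix u
    have "0 \<le> real k * dist w u" by simp
    then show "- B \<le> f u + real k * dist w u" using bound[of u] by linarith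
  qed
  then show ?thesis
    using lipschitz_minorant_le_self[of k w] bound[of w] by linarith
qed

lemma lipschitz_minorant_lipschitz:
  "lipschitz_minorant f k w \<le> lipschitz_minorant f k w' + real k * dist w w'"
proof -
  have "lipschitz_minorant f k w - real k * dist w w' \<le> lipschitz_minorant f k w'"
  proof (rule lipschitz_minorant_ge)
    fix u
    have "real k * dist w u \<le> real k * dist w w' + real k * dist w' u"
      by (metis dist_triangle distrib_left mult_left_mono of_nat_0_le_iff)
    then show "lipschitz_minorant f k w - real k * dist w w' \<le> f u + real k * dist w' u"
      using lipschitz_minorant_le[of k w u] by linarith
  qed
  then show ?thesis by linarith
qed

lemma continuous_on_lipschitz_minorant: "continuous_on UNIV (lipschitz_minorant f k)"
proof (rule continuous_onI)
  fix w :: 'w and e :: real assume e: "e > 0"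
  show "\<exists>d>0. \<forall>w'\<in>UNIV. dist w' w < d \<longrightarrow>
      dist (lipschitz_minorant f k w') (lipschitz_minorant f k w) \<le> e"
  proof (intro exI[of _ "e / (real k + 1)"] conjI ballI impI)
    fix w' assume d: "dist w' w < e / (real k + 1)"
    have "real k * dist w' w \<le> (real k + 1) * dist w' w"
      by (intro mult_right_mono) auto
    also have "\<dots> \<le> e"
      using d by (simp add: field_simps)
    finally show "dist (lipschitz_minorant f k w') (lipschitz_minorant f k w) \<le> e"
      using lipschitz_minorant_lipschitz[of k w w'] lipschitz_minorant_lipschitz[of k w' w]
      by (simp add: dist_real_def dist_commute abs_le_iff)
  qed (use e in auto)
qed

lemma lipschitz_minorant_tendsto:
  assumes lsc: "lower_semicontinuous f"
  shows "(\<lambda>k. lipschitz_minorant f k w) \<longlonglongrightarrow> f w"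
proof (rule order_tendstoI)
  fix c assume "c > f w"
  then show "\<forall>\<^sub>F k in sequentially. lipschitz_minorant f k w < c"
    by (intro always_eventually allI le_less_trans[OF lipschitz_minorant_le_self])
next
  fix c assume "c < f w"
  then obtain c' where c': "c < c'" "c' < f w"
    using dense by blast
  then have "\<forall>\<^sub>F u in nhds w. c' < f u"
    using lsc unfolding lower_semicontinuous_def by blast
  then obtain d where d: "d > 0" "\<And>u. dist u w < d \<Longrightarrow> c' < f u"
    unfolding eventually_nhds_metric by blast
  obtain n where n: "real n * d > c' + B"
    using reals_Archimedean3[OF d(1)] by blast
  have "c < lipschitz_minorant f k w" if k: "k \<ge> n" for k
  proof -
    have "c' \<le> lipschitz_minorant f k w"
    proof (rule lipschitz_minorant_ge)
      fix u
      show "c' \<le> f u + real k * dist w u"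
      proof (cases "dist u w < d")
        case True
        then have "c' < f u" by (rule d(2))
        moreover have "0 \<le> real k * dist w u" by simp
        ultimately show ?thesis by linarith
      next
        case False
        then have "real n * d \<le> real k * dist w u"
          using k d(1) by (intro mult_mono) (auto simp: dist_commute)
        then show ?thesis using n bound[of u] by linarith
      qed
    qed
    then show ?thesis using c' by linarith
  qed
  then show "\<forall>\<^sub>F k in sequentially. c < lipschitz_minorant f k w"
    unfolding eventually_sequentially by blast
qed

end

section \<open>Weak convergence of probability measures\<close>

definition weakly_converges ::
    "(nat \<Rightarrow> 'a::topological_space measure) \<Rightarrow> 'a measure \<Rightarrow> bool" where
  "weakly_converges \<mu> \<mu>0 \<longleftrightarrow> (\<forall>f :: 'a \<Rightarrow> real. continuous_on UNIV f \<longrightarrow> bounded (range f) \<longrightarrow>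
     (\<lambda>n. \<integral>z. f z \<partial>\<mu> n) \<longlonglongrightarrow> (\<integral>z. f z \<partial>\<mu>0))"

lemma weakly_converges_subseq:
  "weakly_converges \<mu> \<mu>0 \<Longrightarrow> strict_mono r \<Longrightarrow> weakly_converges (\<lambda>n. \<mu> (r n)) \<mu>0"
  unfolding weakly_converges_def using LIMSEQ_subseq_LIMSEQ[unfolded o_def] by blast

lemma prob_integrable_bounded:
  fixes f :: "'a::topological_space \<Rightarrow> real"
  assumes M: "M \<in> space (prob_algebra borel)" and f: "f \<in> borel_measurable borel"
    and B: "\<And>z. \<bar>f z\<bar> \<le> B"
  shows "integrable M f"
proof -
  interpret prob_space M using M by (simp add: space_prob_algebra)
  have "f \<in> borel_measurable M"
    using f M by (simp add: space_prob_algebra cong: measurable_cong_sets)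
  then show ?thesis
    by (intro integrable_const_bound[where B = B]) (auto simp: B)
qed

lemma prob_integral_const:
  assumes M: "M \<in> space (prob_algebra borel)"
  shows "(\<integral>z. (c::real) \<partial>M) = c"
proof -
  interpret prob_space M using M by (simp add: space_prob_algebra)
  show ?thesis by (simp add: prob_space)
qed

lemma prob_abs_integral_le:
  fixes f :: "'a::topological_space \<Rightarrow> real"
  assumes M: "M \<in> space (prob_algebra borel)" and f: "f \<in> borel_measurable borel"
    and B: "\<And>z. \<bar>f z\<bar> \<le> B"
  shows "\<bar>\<integral>z. f z \<partial>M\<bar> \<le> B"
proof -
  have "\<bar>\<integral>z. f z \<partial>M\<bar> \<le> (\<integral>z. \<bar>f z\<bar> \<partial>M)"
    by (rule integral_abs_bound)
  also have "\<dots> \<le> (\<integral>z. B \<partial>M)"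
    using f by (intro integral_mono prob_integrable_bounded[OF M, of _ B]) (auto simp: B intro: order_trans[OF abs_ge_zero B])
  also have "\<dots> = B" by (rule prob_integral_const[OF M])
  finally show ?thesis .
qed

text \<open>
  Fatou's lemma for integrals of a jointly lower semicontinuous \<open>f\<close> along a converging parameter
  and weakly converging measures. Each Lipschitz minorant of \<open>f\<close> changes by at most \<open>k * dist\<close>
  when the parameter is moved to its limit, after which weak convergence applies; the minorants
  converge to \<open>f\<close>. The bounds \<open>cs n\<close> may vary so that the lemma also compares with a limit of integrals.
\<close>

lemma weakly_converges_Fatou:
  fixes f :: "'z::metric_space \<times> 'y::metric_space \<Rightarrow> real"
  assumes lsc: "lower_semicontinuous f" and bound: "\<And>w. \<bar>f w\<bar> \<le> B"
    and conv: "weakly_converges \<kappa> \<kappa>0" and z: "zs \<longlonglongrightarrow> z0"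
    and \<kappa>: "\<And>n. \<kappa> n \<in> space (prob_algebra borel)" and \<kappa>0: "\<kappa>0 \<in> space (prob_algebra borel)"
    and le: "\<And>n. (\<integral>y. f (zs n, y) \<partial>\<kappa> n) \<le> cs n" and cs: "cs \<longlonglongrightarrow> c"
  shows "(\<integral>y. f (z0, y) \<partial>\<kappa>0) \<le> c"
proof -
  define g where "g = lipschitz_minorant f"
  have cont: "continuous_on UNIV (\<lambda>y. g k (z, y))" for k z
    unfolding g_def
    by (intro continuous_on_compose2[OF continuous_on_lipschitz_minorant[of f B]] continuous_intros)
      (auto intro: bound)
  have g_bound: "\<bar>g k w\<bar> \<le> B" for k w
    unfolding g_def by (rule abs_lipschitz_minorant_le) (rule bound)
  have g_meas: "(\<lambda>y. g k (z, y)) \<in> borel_measurable borel" for k z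
    by (intro borel_measurable_continuous_onI cont)
  have f_meas: "(\<lambda>y. f (z, y)) \<in> borel_measurable borel" for z
    by (intro lower_semicontinuous_borel_measurable lower_semicontinuous_compose_continuous[OF lsc]
        continuous_intros)
  have step: "(\<integral>y. g k (z0, y) \<partial>\<kappa>0) \<le> c" for k
  proof (rule LIMSEQ_le)
    \<comment> \<open>Only the integrand with the parameter frozen at its limit is tested against weak convergence.\<close>
    have "bounded (range (\<lambda>y. g k (z0, y)))"
      unfolding bounded_iff using g_bound by auto
    then show "(\<lambda>n. \<integral>y. g k (z0, y) \<partial>\<kappa> n) \<longlonglongrightarrow> (\<integral>y. g k (z0, y) \<partial>\<kappa>0)"
      using conv cont unfolding weakly_converges_def by blast
    have "(\<lambda>n. cs n + real k * dist z0 (zs n)) \<longlonglongrightarrow> c + real k * dist z0 z0"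
      by (intro tendsto_intros z cs)
    then show "(\<lambda>n. cs n + real k * dist z0 (zs n)) \<longlonglongrightarrow> c" by simp
    have "(\<integral>y. g k (z0, y) \<partial>\<kappa> n) \<le> cs n + real k * dist z0 (zs n)" for n
    proof -
      have "g k (z0, y) - real k * dist z0 (zs n) \<le> f (zs n, y)" for y
        using lipschitz_minorant_lipschitz[of f B k "(z0, y)" "(zs n, y)"]
          lipschitz_minorant_le_self[of f B k "(zs n, y)"] bound
        by (simp add: g_def dist_Pair_Pair)
      moreover have int: "integrable (\<kappa> n) (\<lambda>y. g k (z0, y))" "integrable (\<kappa> n) (\<lambda>y. f (zs n, y))"
        "integrable (\<kappa> n) (\<lambda>y. real k * dist z0 (zs n))"
        using prob_integrable_bounded[OF \<kappa>[of n] g_meas g_bound]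
          prob_integrable_bounded[OF \<kappa>[of n] f_meas bound] by (auto intro: prob_integrable_bounded[OF \<kappa>])
      ultimately have "(\<integral>y. g k (z0, y) - real k * dist z0 (zs n) \<partial>\<kappa> n) \<le> (\<integral>y. f (zs n, y) \<partial>\<kappa> n)"
        by (intro integral_mono) auto
      then show ?thesis
        using le[of n] int by (simp add: prob_integral_const[OF \<kappa>] del: lebesgue_integral_const)
    qed
    then show "\<exists>N. \<forall>n\<ge>N. (\<integral>y. g k (z0, y) \<partial>\<kappa> n) \<le> cs n + real k * dist z0 (zs n)" by blast
  qed
  have "(\<lambda>k. \<integral>y. g k (z0, y) \<partial>\<kappa>0) \<longlonglongrightarrow> (\<integral>y. f (z0, y) \<partial>\<kappa>0)"
  proof (rule integral_dominated_convergence[where w = "\<lambda>_. B"])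
    show "integrable \<kappa>0 (\<lambda>_. B)"
      by (rule prob_integrable_bounded[OF \<kappa>0, of _ "\<bar>B\<bar>"]) auto
    show "AE y in \<kappa>0. (\<lambda>k. g k (z0, y)) \<longlonglongrightarrow> f (z0, y)"
      unfolding g_def using lipschitz_minorant_tendsto[OF bound lsc] by simp
  qed (use f_meas g_meas g_bound \<kappa>0 in \<open>auto simp: space_prob_algebra cong: measurable_cong_sets\<close>)
  then show ?thesis
    by (rule LIMSEQ_le_const2) (use step in auto)
qed

lemma probs_on_prob_algebra: "\<mu> \<in> probs_on F \<Longrightarrow> \<mu> \<in> space (prob_algebra borel)"
  by (simp add: probs_on_def)

lemma probs_on_iff_AE:
  assumes "F \<in> sets borel"
  shows "\<mu> \<in> probs_on F \<longleftrightarrow> \<mu> \<in> space (prob_algebra borel) \<and> (AE z in \<mu>. z \<in> F)"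
proof -
  have "measure \<mu> F = 1 \<longleftrightarrow> (AE z in \<mu>. z \<in> F)" if "\<mu> \<in> space (prob_algebra borel)"
  proof -
    interpret prob_space \<mu> using that by (simp add: space_prob_algebra)
    have "F \<in> events" using that assms by (simp add: space_prob_algebra)
    then show ?thesis by (rule prob_eq_1)
  qed
  then show ?thesis by (auto simp: probs_on_def)
qed

lemma probs_on_mono:
  assumes "\<mu> \<in> probs_on F" "F \<subseteq> F'" "F \<in> sets borel" "F' \<in> sets borel"
  shows "\<mu> \<in> probs_on F'"
  using assms by (auto simp: probs_on_iff_AE elim!: eventually_mono)

lemma return_probs_on: "F \<in> sets borel \<Longrightarrow> a \<in> F \<Longrightarrow> return borel a \<in> probs_on F"
  by (auto simp: probs_on_def space_prob_algebra measure_return intro: prob_space_return)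

text \<open>
  Convergence with respect to a topology generated by a subbase needs to be checked on the subbase
  only.
\<close>

lemma limitin_weak_topologyI:
  assumes \<mu>: "\<And>n. \<mu> n \<in> probs_on F" and \<mu>0: "\<mu>0 \<in> probs_on F"
    and conv: "\<And>f :: 'a::topological_space \<Rightarrow> real. continuous_on F f \<Longrightarrow> bounded (f ` F) \<Longrightarrow>
      (\<lambda>n. LINT z:F|\<mu> n. f z) \<longlonglongrightarrow> (LINT z:F|\<mu>0. f z)"
  shows "limitin (weak_topology F) \<mu> \<mu>0 sequentially"
  unfolding limitin_def
proof (intro conjI allI impI)
  define \<B> where "\<B> = {{\<mu> \<in> probs_on F. (LINT z:F|\<mu>. f z) \<in> U} | (f :: 'a \<Rightarrow> real) U.
        continuous_on F f \<and> bounded (f ` F) \<and> open U}"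
  have wt: "weak_topology F = topology_generated_by \<B>"
    by (simp add: weak_topology_def \<B>_def)
  have "probs_on F \<in> \<B>"
    unfolding \<B>_def by (intro CollectI exI[of _ "\<lambda>_. 0"] exI[of _ UNIV]) (auto simp: image_constant_conv)
  then show "\<mu>0 \<in> topspace (weak_topology F)"
    unfolding wt topology_generated_by_topspace using \<mu>0 by blast
  fix U assume U: "openin (weak_topology F) U \<and> \<mu>0 \<in> U"
  then have "generate_topology_on \<B> U"
    unfolding wt openin_topology_generated_by_iff by blast
  then have "\<mu>0 \<in> U \<longrightarrow> (\<forall>\<^sub>F n in sequentially. \<mu> n \<in> U)"
  proof induction
    case (Int a b)
    then show ?case by (auto intro: eventually_conj)
  next
    case (UN k)
    then show ?case by (fastforce elim: eventually_mono)
  next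
    case (Basis s)
    then obtain f :: "'a \<Rightarrow> real" and V where s: "s = {\<mu> \<in> probs_on F. (LINT z:F|\<mu>. f z) \<in> V}"
      and fV: "continuous_on F f" "bounded (f ` F)" "open V"
      unfolding \<B>_def by blast
    show ?case
    proof
      assume "\<mu>0 \<in> s"
      then have "\<forall>\<^sub>F n in sequentially. (LINT z:F|\<mu> n. f z) \<in> V"
        using conv[OF fV(1,2)] fV(3) by (auto simp: s intro: topological_tendstoD)
      then show "\<forall>\<^sub>F n in sequentially. \<mu> n \<in> s"
        by eventually_elim (simp add: s \<mu>)
    qed
  qed simp
  then show "\<forall>\<^sub>F n in sequentially. \<mu> n \<in> U"
    using U by blast
qed

text \<open>
  The topology on \<open>probs_on F\<close> is tested by functions that are continuous on \<open>F\<close> only; Tietze's theorem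
  extends them to the whole space.
\<close>

lemma weakly_converges_set_integral:
  fixes f :: "'a::{metric_space, second_countable_topology} \<Rightarrow> real"
  assumes conv: "weakly_converges \<mu> \<mu>0" and F: "closed F"
    and \<mu>: "\<And>n. \<mu> n \<in> probs_on F" and \<mu>0: "\<mu>0 \<in> probs_on F"
    and f: "continuous_on F f" "bounded (f ` F)"
  shows "(\<lambda>n. LINT z:F|\<mu> n. f z) \<longlonglongrightarrow> (LINT z:F|\<mu>0. f z)"
proof -
  obtain B where B: "B > 0" "\<And>z. z \<in> F \<Longrightarrow> norm (f z) \<le> B"
    using f(2) unfolding bounded_pos by blast
  obtain g where g: "continuous_on UNIV g" "\<And>z. z \<in> F \<Longrightarrow> g z = f z" "\<And>z. norm (g z) \<le> B"
    by (rule Tietze[OF f(1), of UNIV B]) (use F B in auto)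
  have "(LINT z:F|\<nu>. f z) = (\<integral>z. g z \<partial>\<nu>)" if "\<nu> \<in> probs_on F" for \<nu>
  proof -
    have [simp]: "sets \<nu> = sets borel"
      using that by (simp add: probs_on_def space_prob_algebra)
    have "(\<lambda>z. indicator F z *\<^sub>R g z) \<in> borel_measurable borel"
      using F by (intro borel_measurable_scaleR borel_measurable_indicator
          borel_measurable_continuous_onI g(1)) auto
    moreover have "g \<in> borel_measurable borel"
      by (intro borel_measurable_continuous_onI g(1))
    moreover have "AE z in \<nu>. indicator F z *\<^sub>R g z = g z"
      using that F probs_on_iff_AE[of F \<nu>] by (auto elim!: eventually_mono)
    ultimately have "(\<integral>z. indicator F z *\<^sub>R g z \<partial>\<nu>) = (\<integral>z. g z \<partial>\<nu>)"
      by (intro integral_cong_AE) (auto cong: measurable_cong_sets)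
    moreover have "indicator F z *\<^sub>R f z = indicator F z *\<^sub>R g z" for z
      using g(2)[of z] by (cases "z \<in> F") auto
    ultimately show ?thesis
      by (simp only: set_lebesgue_integral_def)
  qed
  moreover have "bounded (range g)"
    unfolding bounded_iff using g(3) by auto
  ultimately show ?thesis
    using conv g(1) \<mu> \<mu>0 unfolding weakly_converges_def by simp
qed

lemma weakly_converges_imp_limitin:
  fixes \<mu> :: "nat \<Rightarrow> 'a::{metric_space, second_countable_topology} measure"
  assumes "weakly_converges \<mu> \<mu>0" "closed F" "\<And>n. \<mu> n \<in> probs_on F" "\<mu>0 \<in> probs_on F"
  shows "limitin (weak_topology F) \<mu> \<mu>0 sequentially"
  using assms by (intro limitin_weak_topologyI weakly_converges_set_integral)

text \<open>
  Admissibility of the action survives the limit because the indicator of the complement of a closed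
  graph is a jointly lower semicontinuous function whose integral is the inadmissible mass.
\<close>

lemma probs_on_weak_limit_graph:
  fixes \<Phi> :: "'z::metric_space \<Rightarrow> 'a::metric_space set"
  assumes graph: "closed {(z, a). a \<in> \<Phi> z}"
    and conv: "weakly_converges \<mu> \<mu>0" "zs \<longlonglongrightarrow> z0"
    and \<mu>: "\<And>n. \<mu> n \<in> probs_on (\<Phi> (zs n))" and \<mu>0: "\<mu>0 \<in> space (prob_algebra borel)"
  shows "\<mu>0 \<in> probs_on (\<Phi> z0)"
proof -
  have closed: "closed (\<Phi> z)" for z
  proof -
    have "\<Phi> z = (\<lambda>a. (z, a)) -` {(z, a). a \<in> \<Phi> z}" by auto
    moreover have "closed ((\<lambda>a. (z, a)) -` {(z, a). a \<in> \<Phi> z})"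
      by (intro closed_vimage graph continuous_intros)
    ultimately show ?thesis by simp
  qed
  have eq: "(\<integral>a. indicator (- {(z, a). a \<in> \<Phi> z}) (z, a) \<partial>\<nu>) = 1 - measure \<nu> (\<Phi> z)"
    if \<nu>: "\<nu> \<in> space (prob_algebra borel)" for z \<nu>
  proof -
    interpret prob_space \<nu> using \<nu> by (simp add: space_prob_algebra)
    have [simp]: "sets \<nu> = sets borel" "space \<nu> = UNIV"
      using \<nu> sets_eq_imp_space_eq[of \<nu> borel] by (auto simp: space_prob_algebra)
    have "(\<lambda>a. indicator (- {(z, a). a \<in> \<Phi> z}) (z, a) :: real) = indicator (- \<Phi> z)"
      by (auto simp: indicator_def)
    moreover have "\<Phi> z \<in> events" using closed by simp
    ultimately show ?thesis
      using prob_compl[of "\<Phi> z"] by (simp add: Compl_eq_Diff_UNIV)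
  qed
  have "(\<integral>a. indicator (- {(z, a). a \<in> \<Phi> z}) (z0, a) \<partial>\<mu>0) \<le> (0::real)"
  proof (rule weakly_converges_Fatou[OF lower_semicontinuous_indicator_Compl[OF graph] _ conv])
    show "\<mu> n \<in> space (prob_algebra borel)" for n
      using \<mu> probs_on_prob_algebra by blast
    then show "(\<integral>a. indicator (- {(z, a). a \<in> \<Phi> z}) (zs n, a) \<partial>\<mu> n) \<le> (0::real)" for n
      using \<mu>[of n] by (simp add: eq probs_on_def)
  qed (auto simp: \<mu>0 indicator_def)
  then have "measure \<mu>0 (\<Phi> z0) \<ge> 1"
    by (simp add: eq[OF \<mu>0])
  moreover have "measure \<mu>0 (\<Phi> z0) \<le> 1"
    using \<mu>0 by (intro prob_space.prob_le_1) (simp add: space_prob_algebra)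
  ultimately show ?thesis
    using \<mu>0 by (simp add: probs_on_def)
qed

text \<open>The portmanteau inequality for a fixed closed set, seen as a constant correspondence.\<close>

lemma probs_on_weak_limit:
  fixes F :: "'a::metric_space set"
  assumes "closed F" "weakly_converges \<mu> \<mu>0" "\<And>n. \<mu> n \<in> probs_on F"
    "\<mu>0 \<in> space (prob_algebra borel)"
  shows "\<mu>0 \<in> probs_on F"
proof (rule probs_on_weak_limit_graph[where \<Phi> = "\<lambda>_::real. F"])
  have "{(z::real, a). a \<in> F} = UNIV \<times> F" by auto
  then show "closed {(z::real, a). a \<in> F}"
    using assms(1) by (simp add: closed_Times)
qed (use assms in auto)

lemma Helly_probs_on:
  fixes D :: "real set"
  assumes D: "compact D" and \<mu>: "\<And>n::nat. \<mu> n \<in> probs_on D"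
  obtains r \<mu>0 where "strict_mono r" "\<mu>0 \<in> probs_on D" "weakly_converges (\<lambda>n. \<mu> (r n)) \<mu>0"
proof -
  obtain B where B: "\<And>x. x \<in> D \<Longrightarrow> \<bar>x\<bar> \<le> B"
    using compact_imp_bounded[OF D] unfolding bounded_iff by auto
  have real: "real_distribution (\<mu> n)" for n
    using \<mu>[of n] by (simp add: probs_on_def space_prob_algebra real_distribution_def
        real_distribution_axioms_def)
  have "measure (\<mu> n) {- (\<bar>B\<bar> + 1)<..\<bar>B\<bar> + 1} = 1" for n
  proof -
    have "\<mu> n \<in> probs_on {- (\<bar>B\<bar> + 1)<..\<bar>B\<bar> + 1}"
      using B by (intro probs_on_mono[OF \<mu>]) (use D in \<open>fastforce intro: borel_closed compact_imp_closed\<close>)+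
    then show ?thesis by (simp add: probs_on_def)
  qed
  then have "tight \<mu>"
    unfolding tight_def using real
    by (intro conjI allI impI exI[of _ "- (\<bar>B\<bar> + 1)"] exI[of _ "\<bar>B\<bar> + 1"]) auto
  then obtain r \<mu>0 where r: "strict_mono r" and \<mu>0: "real_distribution \<mu>0"
    and conv: "weak_conv_m (\<lambda>n. \<mu> (r n)) \<mu>0"
    using tight_imp_convergent_subsubsequence[of \<mu> id] by (auto simp: strict_mono_id comp_def)
  have weak: "weakly_converges (\<lambda>n. \<mu> (r n)) \<mu>0"
    unfolding weakly_converges_def
  proof (intro allI impI)
    fix f :: "real \<Rightarrow> real"
    assume f: "continuous_on UNIV f" "bounded (range f)"
    then obtain K where "\<And>x. norm (f x) \<le> K"
      unfolding bounded_iff by auto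
    then show "(\<lambda>n. \<integral>z. f z \<partial>\<mu> (r n)) \<longlonglongrightarrow> (\<integral>z. f z \<partial>\<mu>0)"
      using f(1)
      by (intro weak_conv_imp_integral_bdd_continuous_conv[OF real \<mu>0 conv])
        (auto simp: continuous_on_eq_continuous_at)
  qed
  have "\<mu>0 \<in> space (prob_algebra borel)"
    using \<mu>0 by (simp add: space_prob_algebra real_distribution_def real_distribution_axioms_def)
  then have "\<mu>0 \<in> probs_on D"
    using probs_on_weak_limit[OF _ weak] D \<mu> compact_imp_closed by blast
  then show ?thesis
    using that r weak by blast
qed

section \<open>Prokhorov's theorem on compact sets\<close>

text \<open>
  Base four instead of two leaves gaps between the codes: the digits are only zero or one, so numbers
  that are close together agree in their leading digits.
\<close>

definition binary_code :: "(nat \<Rightarrow> bool) \<Rightarrow> real" where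
  "binary_code e = (\<Sum>j. of_bool (e j) * (1 / 4) ^ j)"

lemma summable_binary_code: "summable (\<lambda>j. of_bool (e j) * (1 / 4) ^ j :: real)"
  by (rule summable_comparison_test'[of "\<lambda>j. (1 / 4) ^ j" 0]) (auto simp: of_bool_def)

lemma binary_code_separated:
  assumes "e k \<noteq> e' k"
  shows "(1 / 4) ^ k / 2 \<le> \<bar>binary_code e - binary_code e'\<bar>"
proof -
  define j where "j = (LEAST j. e j \<noteq> e' j)"
  have j: "e j \<noteq> e' j" "j \<le> k" "\<And>i. i < j \<Longrightarrow> e i = e' i"
    unfolding j_def
    using LeastI[of "\<lambda>j. e j \<noteq> e' j", OF assms] Least_le[of "\<lambda>j. e j \<noteq> e' j", OF assms]
      not_less_Least[of _ "\<lambda>j. e j \<noteq> e' j"] by blast+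
  define d where "d i = (of_bool (e i) - of_bool (e' i) :: real) * (1 / 4) ^ i" for i
  have d_le: "\<bar>d i\<bar> \<le> (1 / 4) ^ i" for i
    by (auto simp: d_def of_bool_def)
  have d_sum: "summable d"
    by (rule summable_comparison_test'[of "\<lambda>j. (1 / 4) ^ j" 0]) (auto simp: d_le)
  \<comment> \<open>The first differing digit contributes \<open>(1/4)^j\<close>, all later ones together at most a third of it.\<close>
  have "binary_code e - binary_code e' = (\<Sum>i. d i)"
    unfolding binary_code_def d_def
    by (subst suminf_diff) (auto simp: summable_binary_code left_diff_distrib)
  also have "\<dots> = (\<Sum>i. d (i + Suc j)) + (\<Sum>i<Suc j. d i)"
    by (rule suminf_split_initial_segment[OF d_sum])
  also have "(\<Sum>i<Suc j. d i) = d j"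
    using j(3) by (simp add: d_def)
  finally have eq: "binary_code e - binary_code e' = (\<Sum>i. d (i + Suc j)) + d j" .
  have geo: "(\<lambda>i. (1 / 4) ^ (i + Suc j) :: real) sums ((1 / 4) ^ j / 3)"
    using sums_mult[OF geometric_sums[of "1 / 4 :: real"], of "(1 / 4) ^ Suc j"]
    by (simp add: power_add field_simps)
  have "\<bar>\<Sum>i. d (i + Suc j)\<bar> \<le> (\<Sum>i. (1 / 4) ^ (i + Suc j))"
    using norm_suminf_le[of "\<lambda>i. d (i + Suc j)" "\<lambda>i. (1 / 4) ^ (i + Suc j)",
        unfolded real_norm_def, OF d_le sums_summable[OF geo]] .
  also have "\<dots> = (1 / 4) ^ j / 3"
    using geo by (rule sums_unique[symmetric])
  finally have tail: "\<bar>\<Sum>i. d (i + Suc j)\<bar> \<le> (1 / 4) ^ j / 3" .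
  have "\<bar>d j\<bar> = (1 / 4) ^ j"
    using j(1) by (auto simp: d_def of_bool_def)
  then have "(1 / 4) ^ j - (1 / 4) ^ j / 3 \<le> \<bar>binary_code e - binary_code e'\<bar>"
    using eq tail by linarith
  moreover have "(1 / 4) ^ k \<le> (1 / 4 :: real) ^ j"
    using j(2) by (intro power_decreasing) auto
  moreover have "0 \<le> (1 / 4 :: real) ^ j" by simp
  ultimately show ?thesis by linarith
qed

text \<open>
  Sequences in an image are lifted to the domain, where the two coordinates of the graph of the code
  can be followed separately.
\<close>

lemma closure_imageE:
  assumes "w \<in> closure (F ` K)"
  obtains p where "\<And>n. p n \<in> K" "(\<lambda>n. F (p n)) \<longlonglongrightarrow> (w :: 'a :: first_countable_topology)"
proof -
  obtain y where y: "\<And>n. y n \<in> F ` K" "y \<longlonglongrightarrow> w"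
    using assms unfolding closure_sequential by blast
  then have "\<forall>n. \<exists>p. p \<in> K \<and> y n = F p" by blast
  then obtain p where "\<forall>n. p n \<in> K \<and> y n = F (p n)"
    by (rule choice[THEN exE])
  moreover from this have "y = (\<lambda>n. F (p n))" by auto
  ultimately show thesis
    using y(2) by (intro that[of p]) auto
qed

text \<open>
  A point is coded by the basic open sets that contain it. A limit of codes of points of \<open>K\<close>
  decodes to a single point: two cluster points of the coded points would be separated by a basic
  open set, while close codes agree on membership in it. Hence the closure of the graph of the
  code is itself the graph of a continuous decoding.
\<close>

lemma compact_real_code:
  fixes K :: "'a::{metric_space, second_countable_topology} set"
  assumes K: "compact K"
  obtains g :: "'a \<Rightarrow> real" and h D where "g \<in> borel_measurable borel" "compact D"
    "continuous_on D h" "h ` D \<subseteq> K" "\<And>a. a \<in> K \<Longrightarrow> g a \<in> D \<and> h (g a) = a"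
proof -
  obtain \<B> :: "'a set set" where \<B>: "countable \<B>" "topological_basis \<B>"
    using ex_countable_basis by blast
  have ne: "\<B> \<noteq> {}"
    using \<B>(2) topological_basisE[of \<B> UNIV] by blast
  define U where "U j = from_nat_into \<B> j" for j
  have U_open: "open (U j)" for j
    unfolding U_def using \<B>(2) ne by (auto intro: topological_basis_open from_nat_into)
  have U_basis: "\<exists>j. a \<in> U j \<and> U j \<subseteq> V" if V: "open V" "a \<in> V" for a V
  proof -
    obtain W where "W \<in> \<B>" "a \<in> W" "W \<subseteq> V"
      using topological_basisE[OF \<B>(2) V] by blast
    then show ?thesis
      using from_nat_into_surj[OF \<B>(1)] unfolding U_def by blast
  qed
  define g where "g a = binary_code (\<lambda>j. a \<in> U j)" for a
  have g_meas: "g \<in> borel_measurable borel"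
  proof -
    have [measurable]: "Measurable.pred borel (\<lambda>a. a \<in> U j)" for j
      using U_open[of j] by (simp add: pred_def)
    show ?thesis unfolding g_def binary_code_def of_bool_def by measurable
  qed
  have g_bound: "g a \<in> {0..2}" for a
  proof -
    have "g a \<le> (\<Sum>j. (1 / 4) ^ j)"
      unfolding g_def binary_code_def
      by (intro suminf_le summable_binary_code) (auto simp: of_bool_def)
    moreover have "0 \<le> g a"
      unfolding g_def binary_code_def by (intro suminf_nonneg summable_binary_code) auto
    ultimately show ?thesis by (simp add: suminf_geometric)
  qed
  define \<Gamma> where "\<Gamma> = closure ((\<lambda>a. (g a, a)) ` K)"
  have sub: "\<Gamma> \<subseteq> {0..2} \<times> K"
    unfolding \<Gamma>_def using g_bound K
    by (intro closure_minimal closed_Times compact_imp_closed) auto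
  have "compact (({0..2::real} \<times> K) \<inter> \<Gamma>)"
    by (intro compact_Int_closed compact_Times K) (simp_all add: \<Gamma>_def)
  moreover have "({0..2::real} \<times> K) \<inter> \<Gamma> = \<Gamma>"
    using sub by blast
  ultimately have \<Gamma>_compact: "compact \<Gamma>" by simp
  have unique: "a = a'" if "(r, a) \<in> \<Gamma>" "(r, a') \<in> \<Gamma>" for r a a'
  proof (rule ccontr)
    assume "a \<noteq> a'"
    then obtain V V' where V: "open V" "open V'" "a \<in> V" "a' \<in> V'" "V \<inter> V' = {}"
      using hausdorff[OF \<open>a \<noteq> a'\<close>] by blast
    then obtain j where j: "a \<in> U j" "U j \<subseteq> V"
      using U_basis by blast
    obtain p where p: "\<And>n. p n \<in> K" "(\<lambda>n. (g (p n), p n)) \<longlonglongrightarrow> (r, a)"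
      using \<open>(r, a) \<in> \<Gamma>\<close> unfolding \<Gamma>_def by (rule closure_imageE) blast
    obtain q where q: "\<And>n. q n \<in> K" "(\<lambda>n. (g (q n), q n)) \<longlonglongrightarrow> (r, a')"
      using \<open>(r, a') \<in> \<Gamma>\<close> unfolding \<Gamma>_def by (rule closure_imageE) blast
    have "\<forall>\<^sub>F n in sequentially. p n \<in> U j"
      using topological_tendstoD[OF tendsto_snd[OF p(2)] U_open] j by simp
    moreover have "\<forall>\<^sub>F n in sequentially. q n \<in> V'"
      using topological_tendstoD[OF tendsto_snd[OF q(2)] V(2)] V by simp
    moreover have "(\<lambda>n. g (p n) - g (q n)) \<longlonglongrightarrow> r - r"
      using tendsto_diff[OF tendsto_fst[OF p(2)] tendsto_fst[OF q(2)]] by simp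
    then have "\<forall>\<^sub>F n in sequentially. dist (g (p n) - g (q n)) 0 < (1 / 4) ^ j / 2"
      by (intro tendstoD) auto
    ultimately have "\<forall>\<^sub>F n in sequentially. False"
    proof eventually_elim
      case (elim n)
      then have "(p n \<in> U j) \<noteq> (q n \<in> U j)"
        using j V by blast
      from binary_code_separated[of "\<lambda>j. p n \<in> U j" j "\<lambda>j. q n \<in> U j", OF this] elim
      show False by (simp add: g_def)
    qed
    then show False by simp
  qed
  define sec where "sec r = (SOME w. w \<in> \<Gamma> \<and> fst w = r)" for r
  have sec: "sec (fst w) = w" if "w \<in> \<Gamma>" for w
  proof -
    have "sec (fst w) \<in> \<Gamma> \<and> fst (sec (fst w)) = fst w"
      unfolding sec_def by (rule someI[of _ w]) (simp add: that)
    then show ?thesis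
      using unique that by (metis prod.collapse)
  qed
  show thesis
  proof
    show "compact (fst ` \<Gamma>)"
      by (intro compact_continuous_image \<Gamma>_compact continuous_intros)
    have "continuous_on (fst ` \<Gamma>) sec"
      by (intro continuous_on_inv \<Gamma>_compact continuous_intros) (auto simp: sec)
    then show "continuous_on (fst ` \<Gamma>) (\<lambda>r. snd (sec r))"
      by (rule continuous_on_snd)
    show "(\<lambda>r. snd (sec r)) ` fst ` \<Gamma> \<subseteq> K"
      using sub sec by fastforce
    fix a assume "a \<in> K"
    then have "(g a, a) \<in> \<Gamma>"
      unfolding \<Gamma>_def by (intro closure_subset[THEN subsetD] imageI)
    then show "g a \<in> fst ` \<Gamma> \<and> snd (sec (g a)) = a"
      using sec by force
  qed (rule g_meas)
qed

text \<open>
  Prokhorov's theorem for a compact set: code the points by real numbers, extract a weak limit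
  there by Helly's theorem, and push it back along the continuous decoding.
\<close>

theorem Prokhorov_probs_on:
  fixes K :: "'a::{metric_space, second_countable_topology} set"
  assumes K: "compact K" and \<mu>: "\<And>n::nat. \<mu> n \<in> probs_on K"
  obtains r \<mu>0 where "strict_mono r" "\<mu>0 \<in> probs_on K" "weakly_converges (\<lambda>n. \<mu> (r n)) \<mu>0"
proof -
  obtain g :: "'a \<Rightarrow> real" and h D where g[measurable]: "g \<in> borel_measurable borel"
    and D: "compact D" and h: "continuous_on D h" "h ` D \<subseteq> K"
    and gh: "\<And>a. a \<in> K \<Longrightarrow> g a \<in> D \<and> h (g a) = a"
    by (rule compact_real_code[OF K]) (rule that)
  have D_closed: "closed D" and [measurable]: "D \<in> sets borel"
    using D by (auto intro: compact_imp_closed borel_closed)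
  have K_closed: "closed K" and [measurable]: "K \<in> sets borel"
    using K by (auto intro: compact_imp_closed borel_closed)
  have \<mu>_prob: "prob_space (\<mu> n)" and \<mu>_sets[measurable_cong, simp]: "sets (\<mu> n) = sets borel" for n
    using \<mu>[of n] by (auto simp: probs_on_def space_prob_algebra)
  have \<mu>_K: "AE a in \<mu> n. a \<in> K" for n
    using \<mu>[of n] by (simp add: probs_on_iff_AE)
  have "K \<noteq> {}"
    using \<mu>[of 0] by (auto simp: probs_on_def)
  then obtain a0 where a0: "a0 \<in> K" by blast
  define h' where "h' r = (if r \<in> D then h r else a0)" for r
  have h'_meas[measurable]: "h' \<in> borel_measurable borel"
    unfolding h'_def by (intro borel_measurable_continuous_on_if h continuous_on_const) simp
  have h'_K: "h' r \<in> K" for r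
    using h(2) a0 by (auto simp: h'_def)
  define \<nu> where "\<nu> n = distr (\<mu> n) borel g" for n
  have \<nu>: "\<nu> n \<in> probs_on D" for n
  proof -
    have "AE a in \<mu> n. g a \<in> D"
      using \<mu>_K[of n] gh by (auto elim!: eventually_mono)
    then show ?thesis
      using prob_space.prob_space_distr[OF \<mu>_prob[of n], of g borel]
      by (simp add: probs_on_iff_AE space_prob_algebra \<nu>_def AE_distr_iff)
  qed
  obtain r \<nu>0 where r: "strict_mono r" and \<nu>0: "\<nu>0 \<in> probs_on D"
    and conv: "weakly_converges (\<lambda>n. \<nu> (r n)) \<nu>0"
    by (rule Helly_probs_on[OF D \<nu>]) (rule that)
  have \<nu>0_prob: "prob_space \<nu>0" and [measurable_cong, simp]: "sets \<nu>0 = sets borel"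
    and \<nu>0_D: "AE z in \<nu>0. z \<in> D"
    using \<nu>0 by (auto simp: probs_on_iff_AE space_prob_algebra)
  define \<mu>0 where "\<mu>0 = distr \<nu>0 borel h'"
  have "\<mu>0 \<in> probs_on K"
    using prob_space.prob_space_distr[OF \<nu>0_prob, of h' borel] h'_K
    by (simp add: probs_on_iff_AE space_prob_algebra \<mu>0_def AE_distr_iff)
  moreover have "weakly_converges (\<lambda>n. \<mu> (r n)) \<mu>0"
    unfolding weakly_converges_def
  proof (intro allI impI)
    fix f :: "'a \<Rightarrow> real"
    assume f: "continuous_on UNIV f" "bounded (range f)"
    have [measurable]: "f \<in> borel_measurable borel"
      by (intro borel_measurable_continuous_onI f(1))
    have restrict: "(LINT z:D|M. f (h z)) = (\<integral>z. f (h' z) \<partial>M)"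
      if [measurable_cong, simp]: "sets M = sets borel" and M: "AE z in M. z \<in> D" for M
    proof -
      have "(LINT z:D|M. f (h z)) = (\<integral>z. indicator D z *\<^sub>R f (h' z) \<partial>M)"
        unfolding set_lebesgue_integral_def
        by (intro Bochner_Integration.integral_cong) (auto simp: h'_def indicator_def)
      also have "\<dots> = (\<integral>z. f (h' z) \<partial>M)"
        by (intro integral_cong_AE) (use M in \<open>auto elim!: eventually_mono\<close>)
      finally show ?thesis .
    qed
    have "(\<lambda>n. LINT z:D|\<nu> (r n). f (h z)) \<longlonglongrightarrow> (LINT z:D|\<nu>0. f (h z))"
    proof (rule weakly_converges_set_integral[OF conv D_closed \<nu> \<nu>0])
      show "continuous_on D (\<lambda>z. f (h z))"
        by (rule continuous_on_compose2[OF f(1) h(1)]) simp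
      show "bounded ((\<lambda>z. f (h z)) ` D)"
        by (rule bounded_subset[OF f(2)]) auto
    qed
    moreover have "(LINT z:D|\<nu> n. f (h z)) = (\<integral>a. f a \<partial>\<mu> n)" for n
    proof -
      have "(LINT z:D|\<nu> n. f (h z)) = (\<integral>a. f (h' (g a)) \<partial>\<mu> n)"
        using \<nu>[of n] restrict[of "\<nu> n"]
        by (auto simp: probs_on_iff_AE space_prob_algebra) (auto simp: \<nu>_def integral_distr)
      also have "AE a in \<mu> n. f (h' (g a)) = f a"
        using \<mu>_K[of n] gh by (auto simp: h'_def elim!: eventually_mono)
      then have "(\<integral>a. f (h' (g a)) \<partial>\<mu> n) = (\<integral>a. f a \<partial>\<mu> n)"
        by (intro integral_cong_AE) measurable
      finally show ?thesis .
    qed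
    moreover have "(LINT z:D|\<nu>0. f (h z)) = (\<integral>a. f a \<partial>\<mu>0)"
      using restrict[of \<nu>0] \<nu>0_D by (auto simp: \<mu>0_def integral_distr)
    ultimately show "(\<lambda>n. \<integral>a. f a \<partial>\<mu> (r n)) \<longlonglongrightarrow> (\<integral>a. f a \<partial>\<mu>0)"
      by simp
  qed
  ultimately show thesis
    using that r by blast
qed

section \<open>Measurable selection of minimizers\<close>

lemma nested_compact_nonempty:
  fixes F :: "nat \<Rightarrow> 'a::t2_space set"
  assumes F: "\<And>n. compact (F n)" "\<And>n. F n \<noteq> {}" and dec: "\<And>n. F (Suc n) \<subseteq> F n"
  shows "(\<Inter>n. F n) \<noteq> {}"
proof -
  have anti: "F m \<subseteq> F n" if "n \<le> m" for m n
    using lift_Suc_antimono_le[of F, OF dec that] .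
  have "F 0 \<inter> (\<Inter>n\<in>UNIV. F n) \<noteq> {}"
  proof (rule compact_imp_fip_image[OF F(1)])
    show "closed (F n)" for n
      by (rule compact_imp_closed[OF F(1)])
    fix I :: "nat set" assume "finite I"
    then have "F (Max (insert 0 I)) \<subseteq> F 0 \<inter> (\<Inter>n\<in>I. F n)"
      by (intro Int_greatest INT_greatest anti Max_ge) auto
    then show "F 0 \<inter> (\<Inter>n\<in>I. F n) \<noteq> {}"
      using F(2) by blast
  qed
  then show ?thesis by blast
qed

definition argmin_set :: "('a \<Rightarrow> real) \<Rightarrow> 'a set \<Rightarrow> 'a set" where
  "argmin_set f S = {a \<in> S. \<forall>a'\<in>S. f a \<le> f a'}"

text \<open>
  The minimizers are the intersection of the sublevel sets at attained levels, and finitely many of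
  these sets share the minimizer among the finitely many points that define them.
\<close>

lemma argmin_set_compact_nonempty:
  fixes S :: "'a::t2_space set"
  assumes S: "compact S" "S \<noteq> {}" and f: "\<And>c. closed {a \<in> S. f a \<le> c}"
  shows "compact (argmin_set f S)" "argmin_set f S \<noteq> {}"
proof -
  have eq: "argmin_set f S = S \<inter> (\<Inter>a'\<in>S. {a \<in> S. f a \<le> f a'})"
    by (auto simp: argmin_set_def)
  show "compact (argmin_set f S)"
    unfolding eq by (intro compact_Int_closed S closed_INT ballI f)
  have "S \<inter> (\<Inter>a'\<in>S. {a \<in> S. f a \<le> f a'}) \<noteq> {}"
  proof (rule compact_imp_fip_image[OF S(1) f])
    fix I assume I: "finite I" "I \<subseteq> S"
    show "S \<inter> (\<Inter>a'\<in>I. {a \<in> S. f a \<le> f a'}) \<noteq> {}"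
    proof (cases "I = {}")
      case False
      have "Min (f ` I) \<in> f ` I"
        using I(1) False by (intro Min_in) auto
      then obtain a where "a \<in> I" "f a = Min (f ` I)" by auto
      then have "a \<in> S \<inter> (\<Inter>a'\<in>I. {a \<in> S. f a \<le> f a'})"
        using I by (auto intro: Min_le)
      then show ?thesis by blast
    qed (use S in auto)
  qed
  then show "argmin_set f S \<noteq> {}"
    unfolding eq .
qed

text \<open>
  Measurability is required for hitting closed sets. In metric spaces this is at least as strong
  as hitting open sets, and for compact values it is inherited directly by sets of minimizers.
\<close>

definition compact_measurable ::
    "('x::topological_space \<Rightarrow> 'a::topological_space set) \<Rightarrow> bool" where
  "compact_measurable \<Psi> \<longleftrightarrow> (\<forall>x. compact (\<Psi> x) \<and> \<Psi> x \<noteq> {}) \<and>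
     (\<forall>F. closed F \<longrightarrow> {x. \<Psi> x \<inter> F \<noteq> {}} \<in> sets borel)"

text \<open>
  The minimum of \<open>f\<close> over \<open>\<Psi> x \<inter> F\<close> is attained, so the minimizers over \<open>\<Psi> x\<close> meet \<open>F\<close> iff this
  minimum is no larger than the one over \<open>\<Psi> x\<close>; comparing the two needs rational levels only.
\<close>

lemma compact_measurable_argmin_set:
  fixes \<Psi> :: "'x::topological_space \<Rightarrow> 'a::t2_space set"
  assumes \<Psi>: "compact_measurable \<Psi>"
    and f: "\<And>x c. closed {a \<in> \<Psi> x. f x a \<le> c}"
    and meas: "\<And>F c. closed F \<Longrightarrow> {x. \<exists>a\<in>\<Psi> x \<inter> F. f x a \<le> c} \<in> sets borel"
  shows "compact_measurable (\<lambda>x. argmin_set (f x) (\<Psi> x))"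
  unfolding compact_measurable_def
proof (intro conjI allI impI)
  have cn: "compact (\<Psi> x)" "\<Psi> x \<noteq> {}" for x
    using \<Psi> by (auto simp: compact_measurable_def)
  show "compact (argmin_set (f x) (\<Psi> x))" "argmin_set (f x) (\<Psi> x) \<noteq> {}" for x
    using argmin_set_compact_nonempty[OF cn f] by blast+
  fix F :: "'a set" assume F: "closed F"
  have "{x. argmin_set (f x) (\<Psi> x) \<inter> F \<noteq> {}} =
    (\<Inter>q::rat. {x. \<exists>a\<in>\<Psi> x \<inter> F. f x a \<le> of_rat q} \<union> (- {x. \<exists>a\<in>\<Psi> x \<inter> UNIV. f x a \<le> of_rat q}))"
    (is "?L = ?R")
  proof (intro set_eqI iffI)
    fix x assume "x \<in> ?L"
    then obtain a where a: "a \<in> \<Psi> x \<inter> F" "\<And>a'. a' \<in> \<Psi> x \<Longrightarrow> f x a \<le> f x a'"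
      by (auto simp: argmin_set_def)
    have "\<exists>a\<in>\<Psi> x \<inter> F. f x a \<le> of_rat q" if "a' \<in> \<Psi> x" "f x a' \<le> of_rat q" for a' q
      using a that by (intro bexI[of _ a]) (auto intro: order_trans)
    then show "x \<in> ?R" by blast
  next
    fix x assume x: "x \<in> ?R"
    obtain m where m: "m \<in> \<Psi> x" "\<And>a'. a' \<in> \<Psi> x \<Longrightarrow> f x m \<le> f x a'"
      using argmin_set_compact_nonempty(2)[OF cn f] by (fastforce simp: argmin_set_def)
    have level: "\<exists>a\<in>\<Psi> x \<inter> F. f x a \<le> of_rat q" if "f x m \<le> of_rat q" for q
      using x m(1) that by auto
    obtain q where "f x m < of_rat q"
      using of_rat_dense[of "f x m" "f x m + 1"] by auto
    then have "\<Psi> x \<inter> F \<noteq> {}"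
      using level[of q] by auto
    moreover have "closed {a \<in> \<Psi> x \<inter> F. f x a \<le> c}" for c
    proof -
      have "{a \<in> \<Psi> x \<inter> F. f x a \<le> c} = {a \<in> \<Psi> x. f x a \<le> c} \<inter> F" by auto
      then show ?thesis using closed_Int[OF f F] by simp
    qed
    ultimately obtain a where a: "a \<in> \<Psi> x \<inter> F" "\<And>a'. a' \<in> \<Psi> x \<inter> F \<Longrightarrow> f x a \<le> f x a'"
      using argmin_set_compact_nonempty(2)[of "\<Psi> x \<inter> F" "f x"] compact_Int_closed[OF cn(1) F]
      by (fastforce simp: argmin_set_def)
    have "f x a \<le> f x m"
    proof (rule ccontr)
      assume "\<not> f x a \<le> f x m"
      then obtain q where q: "f x m < of_rat q" "of_rat q < f x a"
        using of_rat_dense[of "f x m" "f x a"] by auto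
      then obtain a' where "a' \<in> \<Psi> x \<inter> F" "f x a' \<le> of_rat q"
        using level[of q] by auto
      then show False
        using a(2)[of a'] q(2) by linarith
    qed
    then have "a \<in> argmin_set (f x) (\<Psi> x)"
      using a(1) m(2) by (auto simp: argmin_set_def intro: order_trans)
    then show "x \<in> ?L"
      using a(1) by blast
  qed
  moreover have "?R \<in> sets borel"
    by (intro sets.countable_INT'' sets.Un borel_comp meas F closed_UNIV) auto
  ultimately show "{x. argmin_set (f x) (\<Psi> x) \<inter> F \<noteq> {}} \<in> sets borel"
    by simp
qed

text \<open>
  Minimizing successively the distances to the points of a dense sequence shrinks \<open>\<Psi> x\<close> to one
  point, because a point is determined by these distances. The limit point lies in a closed \<open>F\<close> iff
  all the compact sets in the decreasing sequence meet \<open>F\<close>.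
\<close>

lemma compact_measurable_selector:
  fixes \<Psi> :: "'x::topological_space \<Rightarrow> 'a::{metric_space, second_countable_topology} set"
  assumes \<Psi>: "compact_measurable \<Psi>"
  obtains sel where "sel \<in> borel_measurable borel" "\<And>x. sel x \<in> \<Psi> x"
proof -
  obtain D :: "'a set" where D: "countable D" "\<And>X. open X \<Longrightarrow> X \<noteq> {} \<Longrightarrow> \<exists>d\<in>D. d \<in> X"
    by (rule countable_dense_setE) blast
  have D_ne: "D \<noteq> {}"
    using D(2)[of UNIV] by auto
  define d where "d k = from_nat_into D k" for k
  define \<Phi> where "\<Phi> k = rec_nat \<Psi> (\<lambda>k \<Phi> x. argmin_set (dist (d k)) (\<Phi> x)) k" for k
  have \<Phi>_0: "\<Phi> 0 = \<Psi>" and \<Phi>_Suc: "\<Phi> (Suc k) = (\<lambda>x. argmin_set (dist (d k)) (\<Phi> k x))" for k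
    by (simp_all add: \<Phi>_def)
  have \<Phi>: "compact_measurable (\<Phi> k)" for k
  proof (induction k)
    case (Suc k)
    have level: "closed {a. dist (d k) a \<le> c}" for c
      by (intro closed_Collect_le continuous_intros)
    show ?case
      unfolding \<Phi>_Suc
    proof (rule compact_measurable_argmin_set[OF Suc])
      fix x c
      have "closed (\<Phi> k x)"
        using Suc by (auto simp: compact_measurable_def compact_imp_closed)
      moreover have "{a \<in> \<Phi> k x. dist (d k) a \<le> c} = \<Phi> k x \<inter> {a. dist (d k) a \<le> c}" by auto
      ultimately show "closed {a \<in> \<Phi> k x. dist (d k) a \<le> c}"
        using level by (simp add: closed_Int)
    next
      fix F :: "'a set" and c assume "closed F"
      then have "{x. \<Phi> k x \<inter> (F \<inter> {a. dist (d k) a \<le> c}) \<noteq> {}} \<in> sets borel"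
        using Suc level unfolding compact_measurable_def by (metis closed_Int)
      moreover have "{x. \<exists>a\<in>\<Phi> k x \<inter> F. dist (d k) a \<le> c} =
          {x. \<Phi> k x \<inter> (F \<inter> {a. dist (d k) a \<le> c}) \<noteq> {}}" by auto
      ultimately show "{x. \<exists>a\<in>\<Phi> k x \<inter> F. dist (d k) a \<le> c} \<in> sets borel" by simp
    qed
  qed (use \<Psi> \<Phi>_0 in simp)
  have cn: "compact (\<Phi> k x)" "\<Phi> k x \<noteq> {}" for k x
    using \<Phi> by (auto simp: compact_measurable_def)
  have dec: "\<Phi> (Suc k) x \<subseteq> \<Phi> k x" for k x
    by (auto simp: \<Phi>_Suc argmin_set_def)
  have inter: "(\<Inter>k. \<Phi> k x) \<noteq> {}" for x
    by (rule nested_compact_nonempty[of "\<lambda>k. \<Phi> k x"]) (fact cn dec)+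
  have unique: "a = a'" if a: "a \<in> (\<Inter>k. \<Phi> k x)" "a' \<in> (\<Inter>k. \<Phi> k x)" for a a' x
  proof (rule ccontr)
    assume "a \<noteq> a'"
    then obtain e where e: "e \<in> D" "e \<in> ball a (dist a a' / 2)"
      using D(2)[of "ball a (dist a a' / 2)"] by (auto simp del: mem_ball)
    then obtain k where k: "e = d k"
      unfolding d_def by (metis D(1) from_nat_into_surj)
    have "a \<in> \<Phi> (Suc k) x" "a' \<in> \<Phi> (Suc k) x"
      using a by blast+
    then have "dist e a = dist e a'"
      unfolding \<Phi>_Suc k argmin_set_def by (auto intro: antisym)
    then show False
      using e(2) dist_triangle2[of a a' e] by (simp add: dist_commute)
  qed
  define sel where "sel x = (SOME a. a \<in> (\<Inter>k. \<Phi> k x))" for x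
  have sel: "sel x \<in> (\<Inter>k. \<Phi> k x)" for x
    unfolding sel_def by (rule someI_ex) (use inter in blast)
  show thesis
  proof
    show "sel x \<in> \<Psi> x" for x
      using sel[of x] \<Phi>_0 by auto
    show "sel \<in> borel_measurable borel"
    proof (rule borel_measurableI)
      fix U :: "'a set" assume U: "open U"
      have "- (sel -` U) = (\<Inter>k. {x. \<Phi> k x \<inter> - U \<noteq> {}})"
      proof (intro set_eqI iffI)
        fix x assume "x \<in> (\<Inter>k. {x. \<Phi> k x \<inter> - U \<noteq> {}})"
        then have "(\<Inter>k. \<Phi> k x \<inter> - U) \<noteq> {}"
          using dec U by (intro nested_compact_nonempty compact_Int_closed cn) auto
        then obtain a where "a \<in> (\<Inter>k. \<Phi> k x)" "a \<notin> U" by blast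
        then show "x \<in> - (sel -` U)"
          using unique[OF sel] by auto
      qed (use sel in blast)
      moreover have "{x. \<Phi> k x \<inter> - U \<noteq> {}} \<in> sets borel" for k
        using \<Phi>[of k] closed_Compl[OF U] unfolding compact_measurable_def by blast
      then have "(\<Inter>k. {x. \<Phi> k x \<inter> - U \<noteq> {}}) \<in> sets borel"
        by (intro sets.countable_INT'') auto
      ultimately have "- (sel -` U) \<in> sets borel" by simp
      then have "- (- (sel -` U)) \<in> sets borel" by (rule borel_comp)
      then show "sel -` U \<inter> space borel \<in> sets borel" by simp
    qed
  qed
qed

text \<open>
  A compact fibre lets a convergent sequence of base points be lifted to a convergent sequence of
  points of the set.
\<close>

lemma closed_projection_compact:
  fixes S :: "('x::metric_space \<times> 'a::metric_space) set"
  assumes K: "compact K" and S: "closed S" "snd ` S \<subseteq> K"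
  shows "closed (fst ` S)"
  unfolding closed_sequential_limits
proof (intro allI impI)
  fix xs x0 assume xs: "(\<forall>n. xs n \<in> fst ` S) \<and> xs \<longlonglongrightarrow> x0"
  then have "\<forall>n. \<exists>a. (xs n, a) \<in> S" by force
  then obtain as where as: "\<And>n. (xs n, as n) \<in> S" by metis
  then have "as n \<in> K" for n
    using S(2) by force
  then obtain a0 r where r: "strict_mono r" "(\<lambda>n. as (r n)) \<longlonglongrightarrow> a0"
    using compact_imp_seq_compact[OF K] unfolding seq_compact_def comp_def by metis
  have "(\<lambda>n. (xs (r n), as (r n))) \<longlonglongrightarrow> (x0, a0)"
    using xs LIMSEQ_subseq_LIMSEQ[of xs x0 r] r by (intro tendsto_Pair) (auto simp: comp_def)
  then have "(x0, a0) \<in> S"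
    using closed_sequentially[OF S(1), of "\<lambda>n. (xs (r n), as (r n))"] as by blast
  then show "x0 \<in> fst ` S" by force
qed

lemma closed_section:
  assumes "closed S"
  shows "closed {a. (x, a) \<in> S}"
proof -
  have "closed ((\<lambda>a. (x, a)) -` S)"
    by (intro closed_vimage assms continuous_intros)
  then show ?thesis by (simp add: vimage_def)
qed

text \<open>
  Joint semicontinuity makes each set \<open>{x. \<exists>a\<in>\<Phi> x \<inter> F. g x a \<le> c}\<close> the projection of a closed set along a
  compact one, hence closed.
\<close>

theorem measurable_argmin_selector:
  fixes \<Phi> :: "'x::metric_space \<Rightarrow> 'a::{metric_space, second_countable_topology} set"
  assumes K: "compact K" "\<And>x. \<Phi> x \<subseteq> K" and ne: "\<And>x. \<Phi> x \<noteq> {}"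
    and graph: "closed {(x, a). a \<in> \<Phi> x}"
    and g: "\<And>c::real. closed {(x, a). a \<in> \<Phi> x \<and> g x a \<le> c}"
  obtains sel where "sel \<in> borel_measurable borel"
    "\<And>x. sel x \<in> \<Phi> x" "\<And>x a. a \<in> \<Phi> x \<Longrightarrow> g x (sel x) \<le> g x a"
proof -
  have project: "{x. \<exists>a\<in>F. (x, a) \<in> S} \<in> sets borel"
    if "closed S" "S \<subseteq> {(x, a). a \<in> \<Phi> x}" "closed F" for S and F :: "'a set"
  proof -
    have "closed (fst ` (S \<inter> UNIV \<times> F))"
      using that K(2) by (intro closed_projection_compact[OF K(1)] closed_Int closed_Times) fastforce+
    moreover have "fst ` (S \<inter> UNIV \<times> F) = {x. \<exists>a\<in>F. (x, a) \<in> S}" by force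
    ultimately show ?thesis by simp
  qed
  have \<Phi>: "compact_measurable \<Phi>"
    unfolding compact_measurable_def
  proof (intro conjI allI impI ne)
    show "compact (\<Phi> x)" for x
      using compact_Int_closed[OF K(1) closed_section[OF graph, of x]] K(2)[of x]
      by (simp add: Int_absorb1)
    show "{x. \<Phi> x \<inter> F \<noteq> {}} \<in> sets borel" if "closed F" for F
      using project[OF graph _ that] by (simp add: Bex_def Int_def conj_commute ex_in_conv[symmetric])
  qed
  have "compact_measurable (\<lambda>x. argmin_set (g x) (\<Phi> x))"
  proof (rule compact_measurable_argmin_set[OF \<Phi>])
    show "closed {a \<in> \<Phi> x. g x a \<le> c}" for x c
      using closed_section[OF g, of x c] by simp
    show "{x. \<exists>a\<in>\<Phi> x \<inter> F. g x a \<le> c} \<in> sets borel" if "closed F" for F c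
    proof -
      have "{x. \<exists>a\<in>F. (x, a) \<in> {(x, a). a \<in> \<Phi> x \<and> g x a \<le> c}} = {x. \<exists>a\<in>\<Phi> x \<inter> F. g x a \<le> c}"
        by auto
      then show ?thesis
        using project[OF g _ that, of c] by auto
    qed
  qed
  then obtain sel where "sel \<in> borel_measurable borel" "\<And>x. sel x \<in> argmin_set (g x) (\<Phi> x)"
    by (rule compact_measurable_selector) blast
  then show thesis
    by (intro that[of sel]) (auto simp: argmin_set_def)
qed

section \<open>Risk measures and cost distributions\<close>

lemma probs_on_imp_bdd_probs:
  "closed F \<Longrightarrow> bounded F \<Longrightarrow> \<mu> \<in> probs_on F \<Longrightarrow> \<mu> \<in> bdd_probs"
  by (auto simp: bdd_probs_def)

text \<open>Translation invariance of risk measures is phrased with convolutions; shifts are easier to handle.\<close>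

lemma convolution_return:
  fixes \<mu> :: "real measure"
  assumes \<mu>: "\<mu> \<in> space (prob_algebra borel)"
  shows "convolution \<mu> (return borel c) = distr \<mu> borel (\<lambda>z. z + c)"
proof (rule measure_eqI)
  interpret prob_space \<mu> using \<mu> by (simp add: space_prob_algebra)
  have [measurable_cong, simp]: "sets \<mu> = sets borel"
    using \<mu> by (simp add: space_prob_algebra)
  fix B assume "B \<in> sets (convolution \<mu> (return borel c))"
  then have [measurable, simp]: "B \<in> sets borel" by simp
  have "emeasure (convolution \<mu> (return borel c)) B =
      (\<integral>\<^sup>+z. \<integral>\<^sup>+y. indicator B (z + y) \<partial>return borel c \<partial>\<mu>)"
    using prob_space_return[of c borel]
    by (intro convolution_emeasure') (auto intro: prob_space.finite_measure finite_measure)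
  also have "\<dots> = (\<integral>\<^sup>+z. indicator B (z + c) \<partial>\<mu>)"
    by (intro nn_integral_cong nn_integral_return) auto
  also have "\<dots> = (\<integral>\<^sup>+z. indicator B z \<partial>distr \<mu> borel (\<lambda>z. z + c))"
    by (rule nn_integral_distr[symmetric]) auto
  also have "\<dots> = emeasure (distr \<mu> borel (\<lambda>z. z + c)) B"
    by simp
  finally show "emeasure (convolution \<mu> (return borel c)) B =
      emeasure (distr \<mu> borel (\<lambda>z. z + c)) B" .
qed simp

lemma distr_shift_probs_on:
  fixes \<mu> :: "real measure"
  assumes "\<mu> \<in> probs_on {l..u}"
  shows "distr \<mu> borel (\<lambda>z. z + c) \<in> probs_on {l + c..u + c}"
proof -
  have [measurable_cong, simp]: "sets \<mu> = sets borel" and "prob_space \<mu>"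
    and AE: "AE z in \<mu>. z \<in> {l..u}"
    using assms by (auto simp: probs_on_iff_AE space_prob_algebra)
  then have "prob_space (distr \<mu> borel (\<lambda>z. z + c))"
    by (intro prob_space.prob_space_distr) auto
  then show ?thesis
    using AE by (auto simp: probs_on_iff_AE space_prob_algebra AE_distr_iff elim!: eventually_mono)
qed

context
  fixes \<rho> :: "real measure \<Rightarrow> ereal"
  assumes \<rho>: "convex_risk_measure \<rho>"
begin

lemma risk_mono:
  assumes "\<mu> \<in> bdd_probs" "\<mu>' \<in> bdd_probs" "\<And>r. measure \<mu>' {..r} \<le> measure \<mu> {..r}"
  shows "\<rho> \<mu> \<le> \<rho> \<mu>'"
  using \<rho> assms unfolding convex_risk_measure_def by blast

lemma risk_shift:
  assumes "\<mu> \<in> bdd_probs"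
  shows "\<rho> (distr \<mu> borel (\<lambda>z. z + c)) = \<rho> \<mu> + ereal c"
proof -
  have "\<mu> \<in> space (prob_algebra borel)"
    using assms by (auto simp: bdd_probs_def probs_on_def)
  moreover have "\<rho> (convolution \<mu> (return borel c)) = \<rho> \<mu> + ereal c"
    using \<rho> assms unfolding convex_risk_measure_def by blast
  ultimately show ?thesis
    by (simp add: convolution_return)
qed

lemma risk_return: "\<rho> (return borel c) = \<rho> (return borel 0) + ereal c"
proof -
  have "return borel 0 \<in> (bdd_probs :: real measure set)"
    by (rule probs_on_imp_bdd_probs[of "{0}"]) (auto intro: return_probs_on)
  from risk_shift[OF this, of c] show ?thesis
    by (simp add: distr_return)
qed

text \<open>
  A distribution on \<open>[l, u]\<close> lies between the Dirac measures at \<open>l\<close> and \<open>u\<close> in the stochastic order.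
\<close>

lemma risk_bounds:
  assumes \<mu>: "\<mu> \<in> probs_on {l..u}"
  shows "\<rho> \<mu> \<le> \<rho> (return borel 0) + ereal u" "\<rho> (return borel 0) + ereal l \<le> \<rho> \<mu>"
proof -
  interpret prob_space \<mu>
    using \<mu> by (simp add: probs_on_def space_prob_algebra)
  have [measurable_cong, simp]: "sets \<mu> = sets borel" and AE: "AE z in \<mu>. z \<in> {l..u}"
    using \<mu> by (auto simp: probs_on_iff_AE space_prob_algebra)
  have bdd: "\<mu> \<in> bdd_probs"
    by (rule probs_on_imp_bdd_probs[OF _ _ \<mu>]) auto
  have dirac: "return borel c \<in> bdd_probs" for c :: real
    by (rule probs_on_imp_bdd_probs[of "{c}"]) (auto intro: return_probs_on)
  have "measure (return borel u) {..r} \<le> measure \<mu> {..r}" for r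
  proof (cases "u \<le> r")
    case True
    have "AE z in \<mu>. z \<in> {..r}"
      using AE by (rule eventually_mono) (use True in auto)
    then have "measure \<mu> {..r} = 1"
      by (subst prob_eq_1) auto
    then show ?thesis using True by (simp add: measure_return)
  qed (simp add: measure_return)
  then show "\<rho> \<mu> \<le> \<rho> (return borel 0) + ereal u"
    using risk_mono[OF bdd dirac[of u]] by (simp add: risk_return[of u])
  have "measure \<mu> {..r} \<le> measure (return borel l) {..r}" for r
  proof (cases "l \<le> r")
    case False
    have "AE z in \<mu>. z \<notin> {..r}"
      using AE by (rule eventually_mono) (use False in auto)
    then have "measure \<mu> {..r} = 0"
      by (subst prob_eq_0) auto
    then show ?thesis by simp
  qed (simp add: measure_return)
  then show "\<rho> (return borel 0) + ereal l \<le> \<rho> \<mu>"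
    using risk_mono[OF dirac[of l] bdd] by (simp add: risk_return[of l])
qed

end

text \<open>
  The distribution functions compare pointwise as soon as the integrals of the piecewise linear
  approximations of the steps do.
\<close>

lemma cdf_le_if_cts_step_le:
  assumes \<mu>: "\<mu> \<in> space (prob_algebra borel)" and \<mu>': "\<mu>' \<in> space (prob_algebra borel)"
    and le: "\<And>r s. r < s \<Longrightarrow> (\<integral>z. cts_step r s z \<partial>\<mu>) \<le> (\<integral>z. cts_step r s z \<partial>\<mu>')"
  shows "measure \<mu> {..r} \<le> measure \<mu>' {..r}"
proof -
  interpret \<mu>: real_distribution \<mu>
    using \<mu> by (simp add: space_prob_algebra real_distribution_def real_distribution_axioms_def)
  interpret \<mu>': real_distribution \<mu>'
    using \<mu>' by (simp add: space_prob_algebra real_distribution_def real_distribution_axioms_def)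
  have "cdf \<mu> r \<le> cdf \<mu>' s" if "r < s" for s
    using \<mu>.cdf_cts_step(1)[OF that] le[OF that] \<mu>'.cdf_cts_step(2)[OF that] by linarith
  then have "\<forall>\<^sub>F s in at_right r. cdf \<mu> r \<le> cdf \<mu>' s"
    using eventually_at_right_less[of r] by (rule eventually_mono[rotated])
  moreover have "(cdf \<mu>' \<longlongrightarrow> cdf \<mu>' r) (at_right r)"
    using \<mu>'.cdf_is_right_cont[of r] by (simp add: continuous_within)
  ultimately have "cdf \<mu> r \<le> cdf \<mu>' r"
    by (intro tendsto_lowerbound[of "cdf \<mu>'" _ "at_right r"]) auto
  then show ?thesis by (simp add: cdf_def)
qed

text \<open>
  The definition of \<open>cost_law\<close> by its values on Borel sets does not show that these values form a
  measure; the monadic description provides this, and with it the integration theory.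
\<close>

lemma cost_law_eq_bind:
  fixes P :: "('x::topological_space, 'a::topological_space) kernel"
  assumes P: "(\<lambda>a. P t x a) \<in> borel \<rightarrow>\<^sub>M prob_algebra borel"
    and f: "(\<lambda>(a, y). C t x a y + \<gamma> * v y) \<in> borel_measurable (borel \<Otimes>\<^sub>M borel)"
    and \<Lambda>: "\<Lambda> \<in> space (prob_algebra borel)"
  defines "\<kappa> \<equiv> \<lambda>a. distr (P t x a) borel (\<lambda>y. C t x a y + \<gamma> * v y)"
  shows "\<kappa> \<in> borel \<rightarrow>\<^sub>M prob_algebra borel"
    and "cost_law \<gamma> P C v t x \<Lambda> = \<Lambda> \<bind> \<kappa>"
    and "B \<in> sets borel \<Longrightarrow> emeasure (cost_law \<gamma> P C v t x \<Lambda>) B =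
      (\<integral>\<^sup>+a. \<integral>\<^sup>+y. indicator B (C t x a y + \<gamma> * v y) \<partial>P t x a \<partial>\<Lambda>)"
proof -
  have P': "P t x a \<in> space (prob_algebra borel)" for a
    using measurable_space[OF P, of a] by simp
  have sets_P[measurable_cong, simp]: "sets (P t x a) = sets borel" for a
    using P'[of a] by (simp add: space_prob_algebra)
  have f_a[measurable]: "(\<lambda>y. C t x a y + \<gamma> * v y) \<in> borel_measurable borel" for a
    using measurable_compose[OF measurable_Pair1'[of a borel borel] f] by simp
  show \<kappa>: "\<kappa> \<in> borel \<rightarrow>\<^sub>M prob_algebra borel"
  proof (rule measurable_prob_algebraI)
    show "prob_space (\<kappa> a)" for a
      unfolding \<kappa>_def using P'[of a] by (intro prob_space.prob_space_distr) (auto simp: space_prob_algebra)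
    show "\<kappa> \<in> borel \<rightarrow>\<^sub>M subprob_algebra borel"
      unfolding \<kappa>_def by (intro measurable_distr2[OF f] measurable_prob_algebraD P)
  qed
  have em: "emeasure (\<Lambda> \<bind> \<kappa>) B = (\<integral>\<^sup>+a. \<integral>\<^sup>+y. indicator B (C t x a y + \<gamma> * v y) \<partial>P t x a \<partial>\<Lambda>)"
    if [measurable]: "B \<in> sets borel" for B
  proof -
    have "emeasure (\<kappa> a) B = (\<integral>\<^sup>+y. indicator B (C t x a y + \<gamma> * v y) \<partial>P t x a)" for a
    proof -
      have "emeasure (\<kappa> a) B = (\<integral>\<^sup>+z. indicator B z \<partial>\<kappa> a)"
        by (simp add: \<kappa>_def)
      also have "\<dots> = (\<integral>\<^sup>+y. indicator B (C t x a y + \<gamma> * v y) \<partial>P t x a)"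
        unfolding \<kappa>_def by (rule nn_integral_distr) auto
      finally show ?thesis .
    qed
    then show ?thesis
      using emeasure_bind_prob_algebra[OF \<Lambda> \<kappa> that] by simp
  qed
  have sets: "sets (\<Lambda> \<bind> \<kappa>) = sets borel"
    by (rule sets_bind'[OF \<Lambda> \<kappa>])
  then have space: "space (\<Lambda> \<bind> \<kappa>) = UNIV"
    by (simp add: sets_eq_imp_space_eq[OF sets])
  have "cost_law \<gamma> P C v t x \<Lambda> = measure_of UNIV (sets borel) (emeasure (\<Lambda> \<bind> \<kappa>))"
    unfolding cost_law_def
  proof (rule measure_of_eq)
    fix B :: "real set" assume "B \<in> sigma_sets UNIV (sets borel)"
    then have "B \<in> sets borel"
      using sets.sigma_sets_eq[of "borel :: real measure"] by simp
    then show "(\<integral>\<^sup>+a. \<integral>\<^sup>+y. indicator B (C t x a y + \<gamma> * v y) \<partial>P t x a \<partial>\<Lambda>) = emeasure (\<Lambda> \<bind> \<kappa>) B"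
      using em by simp
  qed simp
  also have "\<dots> = \<Lambda> \<bind> \<kappa>"
    using measure_of_of_measure[of "\<Lambda> \<bind> \<kappa>"] by (simp add: sets space)
  finally show eq: "cost_law \<gamma> P C v t x \<Lambda> = \<Lambda> \<bind> \<kappa>" .
  show "B \<in> sets borel \<Longrightarrow> emeasure (cost_law \<gamma> P C v t x \<Lambda>) B =
      (\<integral>\<^sup>+a. \<integral>\<^sup>+y. indicator B (C t x a y + \<gamma> * v y) \<partial>P t x a \<partial>\<Lambda>)"
    unfolding eq by (rule em)
qed

section \<open>One stage of the control problem\<close>

text \<open>
  The hypotheses on a single time \<open>s\<close>. Quasiconcavity is left out because it holds at one time only,
  while lower semicontinuity of the optimal value is needed at all later times. The constant \<open>\<beta>\<close>
  bounds the risk of the zero cost; it is zero in the normalized case.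
\<close>

locale control_stage =
  fixes \<gamma> b \<beta> :: real
    and \<sigma> :: "'x::polish_space risk"
    and A :: "nat \<Rightarrow> 'x \<Rightarrow> 'a::polish_space set"
    and P :: "('x, 'a) kernel"
    and C :: "('x, 'a) cost"
    and s :: nat
  assumes discount: "0 \<le> \<gamma>"
    and risk: "\<And>x. convex_risk_measure (\<sigma> s x)"
    and risk_bound: "\<And>x. \<bar>\<sigma> s x (return borel 0)\<bar> \<le> ereal \<beta>"
    and actions_nonempty: "\<And>x. A s x \<noteq> {}"
    and actions_closed: "\<And>x. closed (A s x)"
    and actions_compact: "compact (\<Union>x. A s x)"
    and actions_uhc: "upper_hemicontinuous (A s)"
    and kernel: "\<And>x a. P s x a \<in> space (prob_algebra borel)"
    and kernel_measurable: "\<And>B. B \<in> sets borel \<Longrightarrow>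
          (\<lambda>(x, a). measure (P s x a) B) \<in> borel_measurable (borel \<Otimes>\<^sub>M borel)"
    and kernel_continuous: "\<And>xs x0 as a0. xs \<longlonglongrightarrow> x0 \<Longrightarrow> as \<longlonglongrightarrow> a0 \<Longrightarrow>
          weakly_converges (\<lambda>n. P s (xs n) (as n)) (P s x0 a0)"
    and risk_lsc: "\<And>K \<mu> \<mu>0 xs x0. compact K \<Longrightarrow>
          (\<And>n. \<mu> n \<in> probs_on K) \<Longrightarrow> \<mu>0 \<in> probs_on K \<Longrightarrow>
          limitin (weak_topology K) \<mu> \<mu>0 sequentially \<Longrightarrow> xs \<longlonglongrightarrow> x0 \<Longrightarrow>
          liminf (\<lambda>n. \<sigma> s (xs n) (\<mu> n)) \<ge> \<sigma> s x0 \<mu>0"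
    and cost_lsc: "lower_semicontinuous (\<lambda>(x, a, y). C s x a y)"
    and cost_bound: "\<And>x a y. \<bar>C s x a y\<bar> \<le> b"
begin

text \<open>
  In a metric space, a limit point outside the closed set \<open>A s x0\<close> would be separated from a
  neighbourhood of that set.
\<close>

lemma actions_graph_closed: "closed {(x, a). a \<in> A s x}"
  unfolding closed_sequential_limits
proof (intro allI impI)
  fix ws w0 assume ws: "(\<forall>n. ws n \<in> {(x, a). a \<in> A s x}) \<and> ws \<longlonglongrightarrow> w0"
  obtain x0 a0 where w0: "w0 = (x0, a0)" by fastforce
  have lim: "(\<lambda>n. fst (ws n)) \<longlonglongrightarrow> x0" "(\<lambda>n. snd (ws n)) \<longlonglongrightarrow> a0"
    using ws tendsto_fst[of ws w0] tendsto_snd[of ws w0] by (auto simp: w0)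
  have "a0 \<in> A s x0"
  proof (rule ccontr)
    assume "a0 \<notin> A s x0"
    then obtain e where e: "e > 0" "\<And>a. dist a a0 < e \<Longrightarrow> a \<notin> A s x0"
      using actions_closed[of x0] unfolding closed_def open_dist by (auto simp: Ball_def)
    define U where "U = {a. e / 2 < dist a a0}"
    have "open U"
      unfolding U_def by (intro open_Collect_less continuous_intros)
    moreover have "A s x0 \<subseteq> U"
    proof
      fix a assume "a \<in> A s x0"
      then have "\<not> dist a a0 < e" using e(2) by blast
      then show "a \<in> U" using e(1) by (simp add: U_def)
    qed
    ultimately obtain V where V: "open V" "x0 \<in> V" "\<And>z. z \<in> V \<Longrightarrow> A s z \<subseteq> U"
      using actions_uhc unfolding upper_hemicontinuous_def by meson
    have "\<forall>\<^sub>F n in sequentially. fst (ws n) \<in> V"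
      by (rule topological_tendstoD[OF lim(1) V(1,2)])
    moreover have "\<forall>\<^sub>F n in sequentially. dist (snd (ws n)) a0 < e / 2"
      using e(1) by (intro tendstoD[OF lim(2)]) simp
    ultimately have "\<forall>\<^sub>F n in sequentially. False"
    proof eventually_elim
      case (elim n)
      have "snd (ws n) \<in> A s (fst (ws n))"
        using ws by (auto simp: case_prod_beta)
      then have "snd (ws n) \<in> U" using V(3) elim(1) by blast
      then show False using elim(2) by (simp add: U_def)
    qed
    then show False by simp
  qed
  then show "w0 \<in> {(x, a). a \<in> A s x}" by (simp add: w0)
qed

lemma actions_borel: "A s x \<in> sets borel"
  by (rule borel_closed[OF actions_closed])

lemma kernel_section_measurable: "(\<lambda>a. P s x a) \<in> borel \<rightarrow>\<^sub>M prob_algebra borel"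
proof (rule measurable_prob_algebraI)
  have P: "prob_space (P s x a)" "sets (P s x a) = sets borel" for a
    using kernel[of x a] by (auto simp: space_prob_algebra)
  show "prob_space (P s x a)" for a by (rule P)
  show "(\<lambda>a. P s x a) \<in> borel \<rightarrow>\<^sub>M subprob_algebra borel"
  proof (rule measurable_subprob_algebra)
    fix B :: "'x set" assume "B \<in> sets borel"
    from measurable_compose[OF measurable_Pair1'[of x borel borel] kernel_measurable[OF this]]
    have "(\<lambda>a. measure (P s x a) B) \<in> borel_measurable borel" by simp
    moreover have "emeasure (P s x a) B = ennreal (measure (P s x a) B)" for a
      using P(1) by (simp add: finite_measure.emeasure_eq_measure prob_space.finite_measure)
    ultimately show "(\<lambda>a. emeasure (P s x a) B) \<in> borel_measurable borel" by simp
  qed (use P prob_space_imp_subprob_space in auto)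
qed

definition stage_cost :: "('x \<Rightarrow> real) \<Rightarrow> 'x \<Rightarrow> 'a \<Rightarrow> 'x \<Rightarrow> real" where
  "stage_cost v x a y = C s x a y + \<gamma> * v y"

abbreviation law :: "('x \<Rightarrow> real) \<Rightarrow> 'x \<Rightarrow> 'a measure \<Rightarrow> real measure" where
  "law v x \<Lambda> \<equiv> cost_law \<gamma> P C v s x \<Lambda>"

abbreviation risk_of :: "('x \<Rightarrow> real) \<Rightarrow> 'x \<Rightarrow> 'a measure \<Rightarrow> ereal" where
  "risk_of v x \<Lambda> \<equiv> G_op \<gamma> \<sigma> P C s \<Lambda> v x"

context
  fixes v :: "'x \<Rightarrow> real" and V :: real
  assumes v_lsc: "lower_semicontinuous v" and v_bound: "\<And>y. \<bar>v y\<bar> \<le> V"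
begin

lemma stage_cost_lsc: "lower_semicontinuous (\<lambda>(w, y). stage_cost v (fst w) (snd w) y)"
proof -
  have "lower_semicontinuous (\<lambda>w. (\<lambda>(x, a, y). C s x a y) (fst (fst w), snd (fst w), snd w))"
    by (intro lower_semicontinuous_compose_continuous[OF cost_lsc] continuous_intros)
  moreover have "mono ((*) \<gamma>)"
    using discount by (intro monoI mult_left_mono)
  then have "lower_semicontinuous (\<lambda>w. \<gamma> * v (snd w))"
    by (intro lower_semicontinuous_compose_mono[where h = "(*) \<gamma>"]
        lower_semicontinuous_compose_continuous[OF v_lsc] continuous_intros)
  ultimately have "lower_semicontinuous (\<lambda>w. (\<lambda>(x, a, y). C s x a y) (fst (fst w), snd (fst w), snd w)
      + \<gamma> * v (snd w))"
    by (rule lower_semicontinuous_add)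
  then show ?thesis
    by (simp add: stage_cost_def case_prod_beta')
qed

lemma stage_cost_bound: "\<bar>stage_cost v x a y\<bar> \<le> b + \<gamma> * V"
proof -
  have "\<bar>\<gamma> * v y\<bar> \<le> \<gamma> * V"
    using discount v_bound[of y] by (simp add: abs_mult mult_left_mono)
  then show ?thesis
    using cost_bound[of x a y] unfolding stage_cost_def by linarith
qed

lemma stage_cost_measurable: "(\<lambda>(a, y). stage_cost v x a y) \<in> borel_measurable (borel \<Otimes>\<^sub>M borel)"
proof -
  have "lower_semicontinuous (\<lambda>w. (\<lambda>(w, y). stage_cost v (fst w) (snd w) y) ((x, fst w), snd w))"
    by (intro lower_semicontinuous_compose_continuous[OF stage_cost_lsc] continuous_intros)
  then have "(\<lambda>w. stage_cost v x (fst w) (snd w)) \<in> borel_measurable borel"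
    by (intro lower_semicontinuous_borel_measurable) simp
  then show ?thesis
    by (simp add: borel_prod case_prod_beta')
qed

lemma stage_cost_section_measurable: "stage_cost v x a \<in> borel_measurable borel"
  using measurable_compose[OF measurable_Pair1'[of a borel borel] stage_cost_measurable] by simp

lemmas law_facts = cost_law_eq_bind[where t = s and v = v and C = C and \<gamma> = \<gamma> and P = P,
    folded stage_cost_def, OF kernel_section_measurable stage_cost_measurable]

lemma law_probs_on:
  assumes \<Lambda>: "\<Lambda> \<in> space (prob_algebra borel)"
  shows "law v x \<Lambda> \<in> probs_on {- (b + \<gamma> * V)..b + \<gamma> * V}"
proof -
  define \<kappa> where "\<kappa> a = distr (P s x a) borel (stage_cost v x a)" for a
  have \<kappa>: "\<kappa> \<in> borel \<rightarrow>\<^sub>M prob_algebra borel" and law: "law v x \<Lambda> = \<Lambda> \<bind> \<kappa>"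
    unfolding \<kappa>_def using law_facts(1,2)[OF \<Lambda>, of x] by simp_all
  have sets_\<Lambda>: "sets \<Lambda> = sets borel"
    using \<Lambda> by (simp add: space_prob_algebra)
  have \<kappa>': "\<kappa> \<in> \<Lambda> \<rightarrow>\<^sub>M subprob_algebra borel"
    using measurable_prob_algebraD[OF \<kappa>] measurable_cong_sets[OF sets_\<Lambda> refl] by blast
  have "AE z in \<kappa> a. z \<in> {- (b + \<gamma> * V)..b + \<gamma> * V}" for a
    unfolding \<kappa>_def using stage_cost_bound stage_cost_section_measurable kernel[of x a]
    by (subst AE_distr_iff) (auto simp: abs_le_iff minus_le_iff space_prob_algebra cong: measurable_cong_sets)
  then have "AE z in \<Lambda> \<bind> \<kappa>. z \<in> {- (b + \<gamma> * V)..b + \<gamma> * V}"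
    by (subst AE_bind[OF \<kappa>']) auto
  then show ?thesis
    unfolding law using prob_space_bind'[OF \<Lambda> \<kappa>] sets_bind'[OF \<Lambda> \<kappa>]
    by (simp add: probs_on_iff_AE space_prob_algebra)
qed

lemma law_prob: "\<Lambda> \<in> space (prob_algebra borel) \<Longrightarrow> law v x \<Lambda> \<in> space (prob_algebra borel)"
  using law_probs_on probs_on_prob_algebra by blast

lemma law_bdd: "\<Lambda> \<in> space (prob_algebra borel) \<Longrightarrow> law v x \<Lambda> \<in> bdd_probs"
  by (rule probs_on_imp_bdd_probs[OF _ _ law_probs_on]) auto

lemma law_integral:
  fixes \<phi> :: "real \<Rightarrow> real"
  assumes \<Lambda>: "\<Lambda> \<in> space (prob_algebra borel)"
    and \<phi>: "\<phi> \<in> borel_measurable borel" and B: "\<And>z. \<bar>\<phi> z\<bar> \<le> B"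
  shows "(\<integral>z. \<phi> z \<partial>law v x \<Lambda>) = (\<integral>a. \<integral>y. \<phi> (stage_cost v x a y) \<partial>P s x a \<partial>\<Lambda>)"
proof -
  define \<kappa> where "\<kappa> a = distr (P s x a) borel (stage_cost v x a)" for a
  have \<kappa>: "\<kappa> \<in> borel \<rightarrow>\<^sub>M prob_algebra borel" and law: "law v x \<Lambda> = \<Lambda> \<bind> \<kappa>"
    unfolding \<kappa>_def using law_facts(1,2)[OF \<Lambda>, of x] by simp_all
  have sets_\<Lambda>: "sets \<Lambda> = sets borel"
    using \<Lambda> by (simp add: space_prob_algebra)
  have \<kappa>': "\<kappa> \<in> \<Lambda> \<rightarrow>\<^sub>M subprob_algebra borel"
    using measurable_prob_algebraD[OF \<kappa>] measurable_cong_sets[OF sets_\<Lambda> refl] by blast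
  have "emeasure (\<kappa> a) (space (\<kappa> a)) = 1" for a
    using measurable_space[OF \<kappa>, of a] by (auto simp: space_prob_algebra intro: prob_space.emeasure_space_1)
  then have "(\<integral>z. \<phi> z \<partial>(\<Lambda> \<bind> \<kappa>)) = (\<integral>a. \<integral>z. \<phi> z \<partial>\<kappa> a \<partial>\<Lambda>)"
    using \<Lambda> B by (intro integral_bind[OF \<phi> _ \<kappa>', where B = B and B' = 1])
      (auto simp: space_prob_algebra intro: prob_space.finite_measure)
  moreover have "(\<integral>z. \<phi> z \<partial>\<kappa> a) = (\<integral>y. \<phi> (stage_cost v x a y) \<partial>P s x a)" for a
    unfolding \<kappa>_def using \<phi> stage_cost_section_measurable kernel[of x a]
    by (intro integral_distr) (auto simp: space_prob_algebra cong: measurable_cong_sets)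
  ultimately show ?thesis
    by (simp add: law)
qed

text \<open>
  Weak limits of the randomized actions pass to the cost distributions only in one direction, since
  the costs are merely lower semicontinuous: Fatou's lemma is used first for the kernel and then for
  the randomized action.
\<close>

lemma law_Fatou:
  fixes \<phi> :: "real \<Rightarrow> real"
  assumes \<phi>: "mono \<phi>" "continuous_on UNIV \<phi>" "\<And>z. \<bar>\<phi> z\<bar> \<le> B"
    and xs: "xs \<longlonglongrightarrow> x0" and conv: "weakly_converges \<Lambda> \<Lambda>0"
    and \<Lambda>: "\<And>n. \<Lambda> n \<in> space (prob_algebra borel)" and \<Lambda>0: "\<Lambda>0 \<in> space (prob_algebra borel)"
    and le: "\<And>n. (\<integral>z. \<phi> z \<partial>law v (xs n) (\<Lambda> n)) \<le> cs n" and cs: "cs \<longlonglongrightarrow> c"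
  shows "(\<integral>z. \<phi> z \<partial>law v x0 \<Lambda>0) \<le> c"
proof -
  define h where "h = (\<lambda>(w, y). \<phi> (stage_cost v (fst w) (snd w) y))"
  define F where "F w = (\<integral>y. h (w, y) \<partial>P s (fst w) (snd w))" for w
  have h_lsc: "lower_semicontinuous h"
    using lower_semicontinuous_compose_mono[OF stage_cost_lsc \<phi>(1,2)]
    by (simp add: h_def case_prod_beta')
  have h_bound: "\<bar>h w\<bar> \<le> B" for w
    using \<phi>(3) by (simp add: h_def case_prod_beta)
  have h_meas: "(\<lambda>y. h (w, y)) \<in> borel_measurable borel" for w
    by (intro lower_semicontinuous_borel_measurable
        lower_semicontinuous_compose_continuous[OF h_lsc] continuous_intros)
  have F_bound: "\<bar>F w\<bar> \<le> B" for w
    unfolding F_def by (rule prob_abs_integral_le[OF kernel h_meas h_bound])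
  have F_lsc: "lower_semicontinuous F"
    unfolding lower_semicontinuous_iff_closed_sublevel closed_sequential_limits
  proof (intro allI impI)
    fix d ws w0 assume ws: "(\<forall>n. ws n \<in> {w. F w \<le> d}) \<and> ws \<longlonglongrightarrow> w0"
    have "(\<integral>y. h (w0, y) \<partial>P s (fst w0) (snd w0)) \<le> d"
    proof (rule weakly_converges_Fatou[OF h_lsc h_bound])
      show "weakly_converges (\<lambda>n. P s (fst (ws n)) (snd (ws n))) (P s (fst w0) (snd w0))"
        using ws by (intro kernel_continuous tendsto_fst tendsto_snd) auto
      show "(\<integral>y. h (ws n, y) \<partial>P s (fst (ws n)) (snd (ws n))) \<le> d" for n
        using ws by (simp add: F_def)
    qed (use ws kernel in auto)
    then show "w0 \<in> {w. F w \<le> d}" by (simp add: F_def)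
  qed
  have \<phi>_meas: "\<phi> \<in> borel_measurable borel"
    by (rule borel_measurable_continuous_onI[OF \<phi>(2)])
  have eq: "(\<integral>z. \<phi> z \<partial>law v x M) = (\<integral>a. F (x, a) \<partial>M)" if "M \<in> space (prob_algebra borel)" for x M
    using law_integral[OF that \<phi>_meas \<phi>(3), of x] by (simp add: F_def h_def)
  have "(\<integral>a. F (x0, a) \<partial>\<Lambda>0) \<le> c"
    by (rule weakly_converges_Fatou[OF F_lsc F_bound conv xs \<Lambda> \<Lambda>0 _ cs])
      (use le in \<open>simp add: eq[OF \<Lambda>]\<close>)
  then show ?thesis by (simp add: eq[OF \<Lambda>0])
qed

text \<open>
  This is joint lower semicontinuity of the risk. A subsequence of the cost distributions has a weak
  limit \<open>\<mu>\<close> by Helly's theorem, and the risk measure is lower semicontinuous along it. The cost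
  distribution at the limiting state and action need not be \<open>\<mu>\<close>, but by Fatou's lemma \<open>\<mu>\<close> dominates it
  stochastically, so monotonicity of the risk measure finishes the argument.
\<close>

lemma risk_of_sublevel_closed:
  assumes xs: "xs \<longlonglongrightarrow> x0" and conv: "weakly_converges \<Lambda> \<Lambda>0"
    and \<Lambda>: "\<And>n. \<Lambda> n \<in> space (prob_algebra borel)" and \<Lambda>0: "\<Lambda>0 \<in> space (prob_algebra borel)"
    and le: "\<And>n. risk_of v (xs n) (\<Lambda> n) \<le> c"
  shows "risk_of v x0 \<Lambda>0 \<le> c"
proof -
  let ?K = "{- (b + \<gamma> * V)..b + \<gamma> * V}"
  obtain r \<mu> where r: "strict_mono r" and \<mu>: "\<mu> \<in> probs_on ?K"
    and weak: "weakly_converges (\<lambda>n. law v (xs (r n)) (\<Lambda> (r n))) \<mu>"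
    by (rule Helly_probs_on[OF compact_Icc law_probs_on[OF \<Lambda>]]) (rule that)
  have xr: "(\<lambda>n. xs (r n)) \<longlonglongrightarrow> x0"
    using LIMSEQ_subseq_LIMSEQ[OF xs r] by (simp add: comp_def)
  have "\<sigma> s x0 \<mu> \<le> liminf (\<lambda>n. \<sigma> s (xs (r n)) (law v (xs (r n)) (\<Lambda> (r n))))"
    by (rule risk_lsc[OF _ law_probs_on[OF \<Lambda>] \<mu> weakly_converges_imp_limitin[OF weak _ law_probs_on[OF \<Lambda>] \<mu>] xr])
      auto
  also have "\<dots> \<le> liminf (\<lambda>n. c)"
    using le by (intro Liminf_mono always_eventually) (simp add: G_op_def)
  finally have "\<sigma> s x0 \<mu> \<le> c"
    by (simp add: Liminf_const)
  moreover have "\<sigma> s x0 (law v x0 \<Lambda>0) \<le> \<sigma> s x0 \<mu>"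
  proof (rule risk_mono[OF risk law_bdd[OF \<Lambda>0]])
    show "\<mu> \<in> bdd_probs"
      by (rule probs_on_imp_bdd_probs[OF _ _ \<mu>]) auto
    show "measure \<mu> {..q} \<le> measure (law v x0 \<Lambda>0) {..q}" for q
    proof (rule cdf_le_if_cts_step_le[OF probs_on_prob_algebra[OF \<mu>] law_prob[OF \<Lambda>0]])
      fix p q :: real assume pq: "p < q"
      have cont: "continuous_on UNIV (cts_step p q)"
        by (rule uniformly_continuous_imp_continuous[OF cts_step_uniformly_continuous[OF pq]])
      have bound: "\<bar>cts_step p q z\<bar> \<le> 1" for z
        using pq by (auto simp: cts_step_def)
      have "bounded (range (cts_step p q))"
        unfolding bounded_iff using bound by auto
      then have lim: "(\<lambda>n. \<integral>z. cts_step p q z \<partial>law v (xs (r n)) (\<Lambda> (r n))) \<longlonglongrightarrow> (\<integral>z. cts_step p q z \<partial>\<mu>)"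
        using weak cont unfolding weakly_converges_def by blast
      \<comment> \<open>The approximate steps decrease, so Fatou's lemma applies to their negatives.\<close>
      have "(\<integral>z. - cts_step p q z \<partial>law v x0 \<Lambda>0) \<le> - (\<integral>z. cts_step p q z \<partial>\<mu>)"
      proof (rule law_Fatou[OF _ _ _ xr weakly_converges_subseq[OF conv r] \<Lambda> \<Lambda>0 _ tendsto_minus[OF lim]])
        show "mono (\<lambda>z. - cts_step p q z)"
          using pq by (intro monoI) (auto simp: cts_step_def divide_simps)
        show "continuous_on UNIV (\<lambda>z. - cts_step p q z)"
          by (intro continuous_intros cont)
        show "\<bar>- cts_step p q z\<bar> \<le> 1" for z using bound by simp
      qed simp
      then show "(\<integral>z. cts_step p q z \<partial>\<mu>) \<le> (\<integral>z. cts_step p q z \<partial>law v x0 \<Lambda>0)" by simp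
    qed
  qed
  ultimately show ?thesis
    by (simp add: G_op_def)
qed

lemma risk_of_bounds:
  assumes \<Lambda>: "\<Lambda> \<in> space (prob_algebra borel)"
  shows "\<bar>risk_of v x \<Lambda>\<bar> \<le> ereal (b + \<gamma> * V + \<beta>)"
proof -
  obtain r where r: "\<sigma> s x (return borel 0) = ereal r" "\<bar>r\<bar> \<le> \<beta>"
    using risk_bound[of x] by (cases "\<sigma> s x (return borel 0)") auto
  have "risk_of v x \<Lambda> \<le> ereal (r + (b + \<gamma> * V))" "ereal (r - (b + \<gamma> * V)) \<le> risk_of v x \<Lambda>"
    using risk_bounds[OF risk law_probs_on[OF \<Lambda>], of x x] by (auto simp: G_op_def r algebra_simps)
  then show ?thesis
    using r(2) by (cases "risk_of v x \<Lambda>") auto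
qed

end

end

context control_stage
begin

text \<open>
  The discount factor appears because raising the continuation value by \<open>d\<close> raises every total cost by
  \<open>\<gamma> * d\<close>, and the risk measure is monotone and translation invariant.
\<close>

lemma risk_of_shift_mono:
  assumes v: "lower_semicontinuous v" "\<And>y. \<bar>v y\<bar> \<le> V" and w: "lower_semicontinuous w" "\<And>y. \<bar>w y\<bar> \<le> W"
    and le: "\<And>y. v y \<le> w y + d" and \<Lambda>: "\<Lambda> \<in> space (prob_algebra borel)"
  shows "risk_of v x \<Lambda> \<le> risk_of w x \<Lambda> + ereal (\<gamma> * d)"
proof -
  let ?\<mu> = "distr (law w x \<Lambda>) borel (\<lambda>z. z + \<gamma> * d)"
  have bdd: "?\<mu> \<in> bdd_probs"
    by (rule probs_on_imp_bdd_probs[OF _ _ distr_shift_probs_on[OF law_probs_on[OF w \<Lambda>]]]) auto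
  have "measure ?\<mu> {..r} \<le> measure (law v x \<Lambda>) {..r}" for r
  proof -
    have sets_w: "sets (law w x \<Lambda>) = sets borel"
      using law_prob[OF w \<Lambda>, of x] by (simp add: space_prob_algebra)
    have shift: "(\<lambda>z. z + \<gamma> * d) -` {..r} = {..r - \<gamma> * d}" by (auto simp: algebra_simps)
    have "emeasure ?\<mu> {..r} = emeasure (law w x \<Lambda>) {..r - \<gamma> * d}"
      using sets_w sets_eq_imp_space_eq[OF sets_w]
      by (subst emeasure_distr) (auto simp: shift cong: measurable_cong_sets)
    also have "\<dots> = (\<integral>\<^sup>+a. \<integral>\<^sup>+y. indicator {..r - \<gamma> * d} (stage_cost w x a y) \<partial>P s x a \<partial>\<Lambda>)"
      by (rule law_facts(3)[OF w \<Lambda>]) simp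
    also have "\<dots> \<le> (\<integral>\<^sup>+a. \<integral>\<^sup>+y. indicator {..r} (stage_cost v x a y) \<partial>P s x a \<partial>\<Lambda>)"
    proof (intro nn_integral_mono)
      fix a y
      have "\<gamma> * v y \<le> \<gamma> * w y + \<gamma> * d"
        using mult_left_mono[OF le[of y] discount] by (simp add: distrib_left)
      then show "indicator {..r - \<gamma> * d} (stage_cost w x a y) \<le> (indicator {..r} (stage_cost v x a y) :: ennreal)"
        by (auto simp: indicator_def stage_cost_def)
    qed
    also have "\<dots> = emeasure (law v x \<Lambda>) {..r}"
      by (rule law_facts(3)[OF v \<Lambda>, symmetric]) simp
    finally have "emeasure ?\<mu> {..r} \<le> emeasure (law v x \<Lambda>) {..r}" .
    moreover have "finite_measure (law v x \<Lambda>)"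
      using law_prob[OF v \<Lambda>, of x] by (simp add: space_prob_algebra prob_space.finite_measure)
    ultimately show ?thesis
      unfolding measure_def by (intro enn2real_mono) (auto simp: finite_measure.emeasure_finite top.not_eq_extremum[symmetric])
  qed
  then have "\<sigma> s x (law v x \<Lambda>) \<le> \<sigma> s x ?\<mu>"
    by (rule risk_mono[OF risk law_bdd[OF v \<Lambda>] bdd])
  also have "\<dots> = \<sigma> s x (law w x \<Lambda>) + ereal (\<gamma> * d)"
    by (rule risk_shift[OF risk law_bdd[OF w \<Lambda>]])
  finally show ?thesis by (simp add: G_op_def)
qed

definition optimal_value :: "('x \<Rightarrow> real) \<Rightarrow> 'x \<Rightarrow> real" where
  "optimal_value v x = real_of_ereal (S_op \<gamma> \<sigma> A P C s v x)"

lemma probs_on_actions_prob: "\<Lambda> \<in> probs_on (A s x) \<Longrightarrow> \<Lambda> \<in> space (prob_algebra borel)"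
  by (rule probs_on_prob_algebra)

lemma ex_probs_on_actions: "\<exists>\<Lambda>. \<Lambda> \<in> probs_on (A s x)"
  using actions_nonempty[of x] return_probs_on[OF actions_borel] by blast

lemma S_op_lower: "\<Lambda> \<in> probs_on (A s x) \<Longrightarrow> S_op \<gamma> \<sigma> A P C s v x \<le> risk_of v x \<Lambda>"
  unfolding S_op_def by (rule INF_lower)

lemma S_op_bounds:
  assumes v: "lower_semicontinuous v" "\<And>y. \<bar>v y\<bar> \<le> V"
  shows "S_op \<gamma> \<sigma> A P C s v x = ereal (optimal_value v x)"
    and "\<bar>optimal_value v x\<bar> \<le> b + \<gamma> * V + \<beta>"
proof -
  define B where "B = b + \<gamma> * V + \<beta>"
  have bnd: "ereal (- B) \<le> risk_of v x \<Lambda>" "risk_of v x \<Lambda> \<le> ereal B" if "\<Lambda> \<in> probs_on (A s x)" for \<Lambda>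
    using risk_of_bounds[OF v probs_on_actions_prob[OF that], of x]
    by (cases "risk_of v x \<Lambda>"; simp add: B_def abs_le_iff)+
  obtain \<Lambda> where \<Lambda>: "\<Lambda> \<in> probs_on (A s x)"
    using ex_probs_on_actions by blast
  have "S_op \<gamma> \<sigma> A P C s v x \<le> ereal B"
    using S_op_lower[OF \<Lambda>] bnd(2)[OF \<Lambda>] by (rule order_trans)
  moreover have "ereal (- B) \<le> S_op \<gamma> \<sigma> A P C s v x"
    unfolding S_op_def by (rule INF_greatest) (rule bnd(1))
  ultimately show "S_op \<gamma> \<sigma> A P C s v x = ereal (optimal_value v x)"
    "\<bar>optimal_value v x\<bar> \<le> b + \<gamma> * V + \<beta>"
    unfolding optimal_value_def B_def[symmetric]
    by (cases "S_op \<gamma> \<sigma> A P C s v x"; simp)+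
qed

text \<open>
  Applied in both directions, this makes the Bellman operator a contraction with factor \<open>\<gamma>\<close> for the
  supremum norm.
\<close>

lemma optimal_value_shift_mono:
  assumes v: "lower_semicontinuous v" "\<And>y. \<bar>v y\<bar> \<le> V" and w: "lower_semicontinuous w" "\<And>y. \<bar>w y\<bar> \<le> W"
    and le: "\<And>y. v y \<le> w y + d"
  shows "optimal_value v x \<le> optimal_value w x + \<gamma> * d"
proof -
  have "ereal (optimal_value v x - \<gamma> * d) \<le> S_op \<gamma> \<sigma> A P C s w x"
    unfolding S_op_def
  proof (rule INF_greatest)
    fix \<Lambda> assume \<Lambda>: "\<Lambda> \<in> probs_on (A s x)"
    have "ereal (optimal_value v x) \<le> risk_of v x \<Lambda>"
      using S_op_lower[OF \<Lambda>] by (simp add: S_op_bounds(1)[OF v, symmetric])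
    also have "\<dots> \<le> risk_of w x \<Lambda> + ereal (\<gamma> * d)"
      by (rule risk_of_shift_mono[OF v w le probs_on_actions_prob[OF \<Lambda>]])
    finally show "ereal (optimal_value v x - \<gamma> * d) \<le> risk_of w x \<Lambda>"
      by (cases "risk_of w x \<Lambda>") auto
  qed
  then show ?thesis by (simp add: S_op_bounds(1)[OF w])
qed

text \<open>
  Nearly optimal randomized actions at \<open>x\<^sub>n \<longlonglongrightarrow> x\<^sub>0\<close> have a weak limit by Prokhorov's theorem, which is
  admissible at \<open>x\<^sub>0\<close> because the action correspondence has closed graph.
\<close>

lemma optimal_value_lsc:
  assumes v: "lower_semicontinuous v" "\<And>y. \<bar>v y\<bar> \<le> V"
  shows "lower_semicontinuous (optimal_value v)"
  unfolding lower_semicontinuous_iff_closed_sublevel closed_sequential_limits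
proof (intro allI impI)
  fix c xs x0 assume xs: "(\<forall>n. xs n \<in> {x. optimal_value v x \<le> c}) \<and> xs \<longlonglongrightarrow> x0"
  have "optimal_value v x0 \<le> c + e" if e: "e > 0" for e
  proof -
    have "\<exists>\<Lambda>. \<Lambda> \<in> probs_on (A s (xs n)) \<and> risk_of v (xs n) \<Lambda> \<le> ereal (c + e)" for n
    proof -
      have "S_op \<gamma> \<sigma> A P C s v (xs n) < ereal (c + e)"
        using xs e by (auto simp: S_op_bounds(1)[OF v] intro: le_less_trans)
      then show ?thesis
        unfolding S_op_def INF_less_iff by (auto intro: less_imp_le)
    qed
    then obtain \<Lambda> where \<Lambda>: "\<And>n. \<Lambda> n \<in> probs_on (A s (xs n))"
      and le: "\<And>n. risk_of v (xs n) (\<Lambda> n) \<le> ereal (c + e)"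
      by metis
    have "\<Lambda> n \<in> probs_on (\<Union>x. A s x)" for n
      using actions_compact
      by (intro probs_on_mono[OF \<Lambda> _ actions_borel]) (auto intro: borel_closed compact_imp_closed)
    then obtain r \<Lambda>0 where r: "strict_mono r" and \<Lambda>0: "\<Lambda>0 \<in> probs_on (\<Union>x. A s x)"
      and conv: "weakly_converges (\<lambda>n. \<Lambda> (r n)) \<Lambda>0"
      by (rule Prokhorov_probs_on[OF actions_compact]) (rule that)
    have xr: "(\<lambda>n. xs (r n)) \<longlonglongrightarrow> x0"
      using LIMSEQ_subseq_LIMSEQ[of xs x0 r] xs r by (simp add: comp_def)
    have "\<Lambda>0 \<in> probs_on (A s x0)"
      by (rule probs_on_weak_limit_graph[OF actions_graph_closed conv xr \<Lambda> probs_on_prob_algebra[OF \<Lambda>0]])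
    then have "S_op \<gamma> \<sigma> A P C s v x0 \<le> risk_of v x0 \<Lambda>0"
      by (rule S_op_lower)
    also have "\<dots> \<le> ereal (c + e)"
      by (rule risk_of_sublevel_closed[OF v xr conv probs_on_prob_algebra[OF \<Lambda>]
            probs_on_prob_algebra[OF \<Lambda>0] le])
    finally show ?thesis by (simp add: S_op_bounds(1)[OF v])
  qed
  then show "x0 \<in> {x. optimal_value v x \<le> c}"
    by (auto intro: field_le_epsilon)
qed

end

section \<open>Deterministic actions are optimal\<close>

lemma weakly_converges_return_shrinking:
  fixes \<Lambda> :: "nat \<Rightarrow> 'a::{metric_space, second_countable_topology} measure"
  assumes \<Lambda>: "\<And>n. \<Lambda> n \<in> probs_on (ball a (1 / Suc n))"
  shows "weakly_converges \<Lambda> (return borel a)"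
  unfolding weakly_converges_def
proof (intro allI impI)
  fix f :: "'a \<Rightarrow> real"
  assume f: "continuous_on UNIV f" "bounded (range f)"
  obtain B where B: "\<And>z. \<bar>f z\<bar> \<le> B"
    using f(2) unfolding bounded_iff by auto
  have f_meas: "f \<in> borel_measurable borel"
    by (rule borel_measurable_continuous_onI[OF f(1)])
  have "(\<lambda>n. \<integral>z. f z \<partial>\<Lambda> n) \<longlonglongrightarrow> f a"
  proof (rule LIMSEQ_I)
    fix e :: real assume e: "e > 0"
    obtain d where d: "d > 0" "\<And>z. dist z a < d \<Longrightarrow> dist (f z) (f a) < e / 2"
      using f(1) half_gt_zero[OF e] unfolding continuous_on_iff by blast
    obtain N where N: "1 / real (Suc N) < d"
      using reals_Archimedean[OF d(1)] by (auto simp: inverse_eq_divide)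
    have "norm ((\<integral>z. f z \<partial>\<Lambda> n) - f a) < e" if n: "n \<ge> N" for n
    proof -
      have \<Lambda>p: "\<Lambda> n \<in> space (prob_algebra borel)" and AE: "AE z in \<Lambda> n. z \<in> ball a (1 / Suc n)"
        using \<Lambda>[of n] by (auto simp: probs_on_iff_AE)
      have "1 / real (Suc n) \<le> 1 / real (Suc N)"
        using n by (simp add: field_simps)
      then have close: "AE z in \<Lambda> n. \<bar>f z - f a\<bar> \<le> e / 2"
        using AE
      proof (elim eventually_mono)
        fix z assume "z \<in> ball a (1 / Suc n)" "1 / real (Suc n) \<le> 1 / real (Suc N)"
        then have "dist z a < d" using N by (simp add: dist_commute)
        then show "\<bar>f z - f a\<bar> \<le> e / 2" using d(2)[of z] by (simp add: dist_real_def)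
      qed
      have int: "integrable (\<Lambda> n) f" "integrable (\<Lambda> n) (\<lambda>_. c)" for c :: real
        by (rule prob_integrable_bounded[OF \<Lambda>p f_meas B])
          (rule prob_integrable_bounded[OF \<Lambda>p, of _ "\<bar>c\<bar>"], auto)
      have "(\<integral>z. f z \<partial>\<Lambda> n) - f a = (\<integral>z. f z - f a \<partial>\<Lambda> n)"
        using int by (simp add: prob_integral_const[OF \<Lambda>p] del: lebesgue_integral_const)
      also have "\<bar>\<dots>\<bar> \<le> (\<integral>z. \<bar>f z - f a\<bar> \<partial>\<Lambda> n)"
        by (rule integral_abs_bound)
      also have "\<dots> \<le> (\<integral>z. e / 2 \<partial>\<Lambda> n)"
        by (rule integral_mono_AE[OF integrable_abs[OF Bochner_Integration.integrable_diff[OF int]] int(2) close])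
      also have "\<dots> = e / 2" by (rule prob_integral_const[OF \<Lambda>p])
      finally show ?thesis using e by simp
    qed
    then show "\<exists>N. \<forall>n\<ge>N. norm ((\<integral>z. f z \<partial>\<Lambda> n) - f a) < e" by blast
  qed
  moreover have "(\<integral>z. f z \<partial>return borel a) = f a"
    by (rule integral_return) (use f_meas in auto)
  ultimately show "(\<lambda>n. \<integral>z. f z \<partial>\<Lambda> n) \<longlonglongrightarrow> (\<integral>z. f z \<partial>return borel a)" by simp
qed

lemma weakly_converges_return:
  fixes as :: "nat \<Rightarrow> 'a::topological_space"
  assumes "as \<longlonglongrightarrow> a"
  shows "weakly_converges (\<lambda>n. return borel (as n)) (return borel a)"
  unfolding weakly_converges_def
proof (intro allI impI)
  fix f :: "'a \<Rightarrow> real" assume f: "continuous_on UNIV f"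
  have "(\<integral>z. f z \<partial>return borel u) = f u" for u
    by (rule integral_return) (use borel_measurable_continuous_onI[OF f] in auto)
  moreover have "(\<lambda>n. f (as n)) \<longlonglongrightarrow> f a"
    by (rule continuous_on_tendsto_compose[OF f assms]) auto
  ultimately show "(\<lambda>n. \<integral>z. f z \<partial>return borel (as n)) \<longlonglongrightarrow> (\<integral>z. f z \<partial>return borel a)" by simp
qed

lemma return_prob: "return borel a \<in> space (prob_algebra borel)"
  by (simp add: space_prob_algebra prob_space_return)

lemma uniform_measure_probs_on:
  assumes \<Lambda>: "\<Lambda> \<in> probs_on S" and U: "U \<in> sets borel" "measure \<Lambda> U \<noteq> 0"
    and S: "S \<in> sets borel" "S' \<in> sets borel" "S \<inter> U \<subseteq> S'"
  shows "uniform_measure \<Lambda> U \<in> probs_on S'"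
proof -
  interpret prob_space \<Lambda> using \<Lambda> by (simp add: probs_on_def space_prob_algebra)
  have [simp]: "sets \<Lambda> = sets borel" and AE: "AE z in \<Lambda>. z \<in> S"
    using \<Lambda> S by (auto simp: probs_on_iff_AE space_prob_algebra)
  have "prob_space (uniform_measure \<Lambda> U)"
    using U by (intro prob_space_uniform_measure) (auto simp: emeasure_eq_measure)
  moreover have "AE z in uniform_measure \<Lambda> U. z \<in> S'"
    using U S(3) AE by (intro AE_uniform_measureI) (auto elim!: eventually_mono)
  ultimately show ?thesis
    using S by (simp add: probs_on_iff_AE space_prob_algebra)
qed

context control_stage
begin

text \<open>
  Conditioning a randomized action on a set and on its complement splits the cost distribution into
  the corresponding mixture, since the cost distribution is linear in the randomized action.
\<close>

lemma law_mixture: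
  assumes v: "lower_semicontinuous v" "\<And>y. \<bar>v y\<bar> \<le> V"
    and \<Lambda>: "\<Lambda> \<in> space (prob_algebra borel)" and U: "U \<in> sets borel"
    and pos: "measure \<Lambda> U \<noteq> 0" "measure \<Lambda> (- U) \<noteq> 0"
  shows "law v x \<Lambda> =
    mixture (measure \<Lambda> U) (law v x (uniform_measure \<Lambda> U)) (law v x (uniform_measure \<Lambda> (- U)))"
proof -
  interpret prob_space \<Lambda> using \<Lambda> by (simp add: space_prob_algebra)
  have [simp, measurable_cong]: "sets \<Lambda> = sets borel"
    using \<Lambda> by (simp add: space_prob_algebra)
  have [simp]: "space \<Lambda> = UNIV"
    using sets_eq_imp_space_eq[of \<Lambda> borel] by simp
  have compl: "measure \<Lambda> (- U) = 1 - measure \<Lambda> U"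
    using prob_compl[of U] U by (simp add: Compl_eq_Diff_UNIV)
  have \<Lambda>': "\<Lambda> \<in> probs_on UNIV"
    using \<Lambda> prob_space by (simp add: probs_on_def)
  define \<kappa> where "\<kappa> a = distr (P s x a) borel (stage_cost v x a)" for a
  have \<kappa>: "\<kappa> \<in> borel \<rightarrow>\<^sub>M prob_algebra borel"
    unfolding \<kappa>_def using law_facts(1)[OF v \<Lambda>, of x] by simp
  have em: "emeasure (law v x M) B = (\<integral>\<^sup>+a. emeasure (\<kappa> a) B \<partial>M)"
    if "M \<in> space (prob_algebra borel)" "B \<in> sets borel" for M B
    using law_facts(2)[OF v that(1), of x, folded \<kappa>_def] emeasure_bind_prob_algebra[OF that(1) \<kappa> that(2)]
    by simp
  have part: "ennreal (measure \<Lambda> S) * emeasure (law v x (uniform_measure \<Lambda> S)) B =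
      (\<integral>\<^sup>+a. emeasure (\<kappa> a) B * indicator S a \<partial>\<Lambda>)"
    if S: "S \<in> sets borel" "measure \<Lambda> S \<noteq> 0" and B: "B \<in> sets borel" for S B
  proof -
    have u: "uniform_measure \<Lambda> S \<in> space (prob_algebra borel)"
      by (rule probs_on_prob_algebra[OF uniform_measure_probs_on[OF \<Lambda>' S, of UNIV]]) auto
    have meas: "(\<lambda>a. emeasure (\<kappa> a) B) \<in> borel_measurable \<Lambda>"
      using measurable_compose[OF measurable_prob_algebraD[OF \<kappa>] measurable_emeasure_subprob_algebra[OF B]]
      by (simp cong: measurable_cong_sets)
    have "emeasure (law v x (uniform_measure \<Lambda> S)) B =
        (\<integral>\<^sup>+a. emeasure (\<kappa> a) B * indicator S a \<partial>\<Lambda>) / emeasure \<Lambda> S"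
      unfolding em[OF u B] using S by (intro nn_integral_uniform_measure meas) simp
    moreover have "emeasure \<Lambda> S \<noteq> 0" "emeasure \<Lambda> S \<noteq> top"
      using S by (auto simp: emeasure_eq_measure)
    ultimately show ?thesis
      unfolding emeasure_eq_measure[symmetric]
      by (simp add: ennreal_times_divide mult.commute[of "emeasure \<Lambda> S"] ennreal_mult_divide_eq)
  qed
  have sets: "sets (law v x \<Lambda>) = sets borel"
    using law_prob[OF v \<Lambda>, of x] by (simp add: space_prob_algebra)
  have "mixture (measure \<Lambda> U) (law v x (uniform_measure \<Lambda> U)) (law v x (uniform_measure \<Lambda> (- U))) =
      measure_of UNIV (sets borel) (emeasure (law v x \<Lambda>))"
    unfolding mixture_def
  proof (rule measure_of_eq)
    fix B :: "real set" assume "B \<in> sigma_sets UNIV (sets borel)"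
    then have B: "B \<in> sets borel"
      using sets.sigma_sets_eq[of "borel :: real measure"] by simp
    have meas: "(\<lambda>a. emeasure (\<kappa> a) B) \<in> borel_measurable \<Lambda>"
      using measurable_compose[OF measurable_prob_algebraD[OF \<kappa>] measurable_emeasure_subprob_algebra[OF B]]
      by (simp cong: measurable_cong_sets)
    have U': "- U \<in> sets borel" using U by (rule borel_comp)
    have "ennreal (measure \<Lambda> U) * emeasure (law v x (uniform_measure \<Lambda> U)) B +
        ennreal (1 - measure \<Lambda> U) * emeasure (law v x (uniform_measure \<Lambda> (- U))) B =
        (\<integral>\<^sup>+a. emeasure (\<kappa> a) B * indicator U a \<partial>\<Lambda>) + (\<integral>\<^sup>+a. emeasure (\<kappa> a) B * indicator (- U) a \<partial>\<Lambda>)"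
      using part[OF U pos(1) B] part[OF U' pos(2) B] by (simp add: compl)
    also have "\<dots> = (\<integral>\<^sup>+a. emeasure (\<kappa> a) B * indicator U a + emeasure (\<kappa> a) B * indicator (- U) a \<partial>\<Lambda>)"
      using U U' meas by (intro nn_integral_add[symmetric]) auto
    also have "\<dots> = (\<integral>\<^sup>+a. emeasure (\<kappa> a) B \<partial>\<Lambda>)"
      by (intro nn_integral_cong) (auto simp: indicator_def)
    finally show "ennreal (measure \<Lambda> U) * emeasure (law v x (uniform_measure \<Lambda> U)) B +
        ennreal (1 - measure \<Lambda> U) * emeasure (law v x (uniform_measure \<Lambda> (- U))) B =
        emeasure (law v x \<Lambda>) B"
      by (simp add: em[OF \<Lambda> B])
  qed simp
  also have "\<dots> = law v x \<Lambda>"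
    using measure_of_of_measure[of "law v x \<Lambda>"] sets sets_eq_imp_space_eq[OF sets] by simp
  finally show ?thesis by simp
qed

text \<open>
  Otherwise distributions of low risk on shrinking balls would converge weakly to the Dirac measure at
  the centre, and lower semicontinuity would give this measure low risk as well.
\<close>

lemma risk_of_return_local:
  assumes v: "lower_semicontinuous v" "\<And>y. \<bar>v y\<bar> \<le> V"
    and c: "c < risk_of v x (return borel a)"
  shows "\<exists>e>0. \<forall>\<Lambda>\<in>probs_on (ball a e). c < risk_of v x \<Lambda>"
proof (rule ccontr)
  assume contra: "\<not> ?thesis"
  have "\<exists>\<Lambda>. \<Lambda> \<in> probs_on (ball a (1 / Suc n)) \<and> risk_of v x \<Lambda> \<le> c" for n
    using contra by (auto simp: not_less dest!: spec[of _ "1 / Suc n"])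
  then obtain \<Lambda> where \<Lambda>: "\<And>n. \<Lambda> n \<in> probs_on (ball a (1 / Suc n))"
    and le: "\<And>n. risk_of v x (\<Lambda> n) \<le> c"
    by metis
  have "risk_of v x (return borel a) \<le> c"
    by (rule risk_of_sublevel_closed[OF v tendsto_const weakly_converges_return_shrinking[OF \<Lambda>]
          probs_on_prob_algebra[OF \<Lambda>] return_prob le])
  then show False using c by simp
qed

context
  assumes quasiconcave: "\<And>x \<mu>1 \<mu>2 \<theta>. \<mu>1 \<in> bdd_probs \<Longrightarrow> \<mu>2 \<in> bdd_probs \<Longrightarrow> \<theta> \<in> {0..1} \<Longrightarrow>
          \<sigma> s x (mixture \<theta> \<mu>1 \<mu>2) \<ge> min (\<sigma> s x \<mu>1) (\<sigma> s x \<mu>2)"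
begin

text \<open>
  Induction on the cover, splitting off one of its sets at a time. Conditioning on a null set is
  meaningless, hence the separate cases of a set that carries no mass or all of it.
\<close>

lemma risk_of_gt_on_finite_cover:
  assumes v: "lower_semicontinuous v" "\<And>y. \<bar>v y\<bar> \<le> V"
    and \<U>: "finite \<U>" "\<And>U. U \<in> \<U> \<Longrightarrow> U \<in> sets borel"
    and gt: "\<And>U \<Lambda>. U \<in> \<U> \<Longrightarrow> \<Lambda> \<in> probs_on U \<Longrightarrow> c < risk_of v x \<Lambda>"
    and \<Lambda>: "\<Lambda> \<in> probs_on (\<Union>\<U>)"
  shows "c < risk_of v x \<Lambda>"
  using \<U> gt \<Lambda>
proof (induction \<U> arbitrary: \<Lambda> rule: finite_induct)
  case empty
  then show ?case by (simp add: probs_on_def)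
next
  case (insert U \<U>)
  interpret prob_space \<Lambda>
    using insert.prems by (simp add: probs_on_def space_prob_algebra)
  have \<Lambda>p: "\<Lambda> \<in> space (prob_algebra borel)"
    using insert.prems(3) by (rule probs_on_prob_algebra)
  then have [simp]: "sets \<Lambda> = sets borel" by (simp add: space_prob_algebra)
  have [simp]: "space \<Lambda> = UNIV"
    using sets_eq_imp_space_eq[of \<Lambda> borel] by simp
  have U: "U \<in> sets borel" "- U \<in> sets borel"
    using insert.prems(1)[of U] by (auto intro: borel_comp)
  have Un: "\<Union>\<U> \<in> sets borel" "\<Union>(insert U \<U>) \<in> sets borel"
    using insert.hyps(1) insert.prems(1) by (auto intro!: sets.finite_Union)
  have compl: "measure \<Lambda> (- U) = 1 - measure \<Lambda> U"
    using prob_compl[of U] U by (simp add: Compl_eq_Diff_UNIV)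
  have gtU: "c < risk_of v x M" if "M \<in> probs_on U" for M
    using insert.prems(2)[of U M] that by simp
  have gtUn: "c < risk_of v x M" if "M \<in> probs_on (\<Union>\<U>)" for M
    by (rule insert.IH[OF _ _ that]) (use insert.prems(1,2) in auto)
  consider "measure \<Lambda> U = 1" | "measure \<Lambda> U = 0" | "measure \<Lambda> U \<noteq> 0" "measure \<Lambda> (- U) \<noteq> 0"
    using compl by linarith
  then show ?case
  proof cases
    case 1
    then show ?thesis
      using \<Lambda>p by (intro gtU) (simp add: probs_on_def)
  next
    case 2
    have "AE z in \<Lambda>. z \<in> \<Union>(insert U \<U>)"
      using insert.prems(3) Un by (simp add: probs_on_iff_AE)
    moreover have "AE z in \<Lambda>. z \<notin> U"
      using 2 U by (subst (asm) prob_eq_0) auto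
    ultimately have "AE z in \<Lambda>. z \<in> \<Union>\<U>"
      by eventually_elim auto
    then show ?thesis
      using \<Lambda>p Un by (intro gtUn) (simp add: probs_on_iff_AE)
  next
    case 3
    have u: "uniform_measure \<Lambda> U \<in> probs_on U"
      by (rule uniform_measure_probs_on[OF insert.prems(3) U(1) 3(1) Un(2) U(1)]) auto
    have u': "uniform_measure \<Lambda> (- U) \<in> probs_on (\<Union>\<U>)"
      by (rule uniform_measure_probs_on[OF insert.prems(3) U(2) 3(2) Un(2) Un(1)]) auto
    have "c < min (risk_of v x (uniform_measure \<Lambda> U)) (risk_of v x (uniform_measure \<Lambda> (- U)))"
      using gtU[OF u] gtUn[OF u'] by simp
    also have "\<dots> \<le> \<sigma> s x (mixture (measure \<Lambda> U) (law v x (uniform_measure \<Lambda> U)) (law v x (uniform_measure \<Lambda> (- U))))"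
      unfolding G_op_def
      using law_bdd[OF v probs_on_prob_algebra[OF u]] law_bdd[OF v probs_on_prob_algebra[OF u']]
      by (intro quasiconcave) auto
    also have "\<dots> = risk_of v x \<Lambda>"
      unfolding G_op_def using law_mixture[OF v \<Lambda>p U(1) 3] by simp
    finally show ?thesis .
  qed
qed

text \<open>
  Below \<open>m\<close>, every level is exceeded by the risk of all distributions on some ball around each action.
  Finitely many of these balls cover the compact action set, and quasiconcavity is applied to the
  decomposition of the randomized action along them. Approximating the randomized action by finitely
  supported ones would not do: lower semicontinuity bounds the risk of the limit only from above.
\<close>

lemma randomization_no_gain:
  assumes v: "lower_semicontinuous v" "\<And>y. \<bar>v y\<bar> \<le> V"
    and m: "\<And>a. a \<in> A s x \<Longrightarrow> m \<le> risk_of v x (return borel a)"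
    and \<Lambda>: "\<Lambda> \<in> probs_on (A s x)"
  shows "m \<le> risk_of v x \<Lambda>"
proof (rule dense_le)
  fix c assume c: "c < m"
  have "\<exists>e>0. \<forall>\<Lambda>\<in>probs_on (ball a e). c < risk_of v x \<Lambda>" if "a \<in> A s x" for a
    by (rule risk_of_return_local[OF v]) (rule less_le_trans[OF c m[OF that]])
  then obtain e where e: "\<And>a. a \<in> A s x \<Longrightarrow> e a > 0"
    "\<And>a \<Lambda>. a \<in> A s x \<Longrightarrow> \<Lambda> \<in> probs_on (ball a (e a)) \<Longrightarrow> c < risk_of v x \<Lambda>"
    by metis
  have "A s x = (\<Union>x. A s x) \<inter> A s x" by blast
  then have "compact (A s x)"
    using compact_Int_closed[OF actions_compact actions_closed] by metis
  then obtain D where D: "D \<subseteq> A s x" "finite D" "A s x \<subseteq> (\<Union>a\<in>D. ball a (e a))"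
    by (rule compactE_image[of "A s x" "A s x" "\<lambda>a. ball a (e a)"]) (use e(1) in auto)
  have \<Lambda>_cover: "\<Lambda> \<in> probs_on (\<Union>a\<in>D. ball a (e a))"
    by (rule probs_on_mono[OF \<Lambda> D(3) actions_borel]) (intro borel_open open_UN ballI open_ball)
  have "c < risk_of v x \<Lambda>"
  proof (rule risk_of_gt_on_finite_cover[OF v])
    show "finite ((\<lambda>a. ball a (e a)) ` D)" using D(2) by simp
    show "U \<in> sets borel" if "U \<in> (\<lambda>a. ball a (e a)) ` D" for U
      using that by (auto intro: borel_open)
    show "c < risk_of v x M" if "U \<in> (\<lambda>a. ball a (e a)) ` D" "M \<in> probs_on U" for U M
      using that D(1) e(2) by blast
  qed (fact \<Lambda>_cover)
  then show "c \<le> risk_of v x \<Lambda>" by simp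
qed

text \<open>
  The Dirac minimizers are selected among the actions; they are optimal among all randomized actions
  because randomization brings no gain.
\<close>

theorem ex_optimal_dirac_policy:
  assumes v: "lower_semicontinuous v" "\<And>y. \<bar>v y\<bar> \<le> V"
  shows "\<exists>\<pi>. optimal_dirac_policy \<gamma> \<sigma> A P C s v \<pi>"
proof -
  define g where "g x a = real_of_ereal (risk_of v x (return borel a))" for x a
  have g: "risk_of v x (return borel a) = ereal (g x a)" for x a
    using risk_of_bounds[OF v return_prob[of a], of x] unfolding g_def
    by (cases "risk_of v x (return borel a)") auto
  obtain sel where sel: "sel \<in> borel_measurable borel" "\<And>x. sel x \<in> A s x"
    "\<And>x a. a \<in> A s x \<Longrightarrow> g x (sel x) \<le> g x a"
  proof (rule measurable_argmin_selector[OF actions_compact _ actions_nonempty actions_graph_closed])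
    show "A s x \<subseteq> (\<Union>x. A s x)" for x by blast
    show "closed {(x, a). a \<in> A s x \<and> g x a \<le> c}" for c
      unfolding closed_sequential_limits
    proof (intro allI impI)
      fix ws w0 assume ws: "(\<forall>n. ws n \<in> {(x, a). a \<in> A s x \<and> g x a \<le> c}) \<and> ws \<longlonglongrightarrow> w0"
      then have lim: "(\<lambda>n. fst (ws n)) \<longlonglongrightarrow> fst w0" "(\<lambda>n. snd (ws n)) \<longlonglongrightarrow> snd w0"
        by (auto intro: tendsto_fst tendsto_snd)
      have mem: "ws n \<in> {(x, a). a \<in> A s x}" and le: "g (fst (ws n)) (snd (ws n)) \<le> c" for n
        using ws by (auto simp: case_prod_beta)
      have "w0 \<in> {(x, a). a \<in> A s x}"
        using closed_sequentially[OF actions_graph_closed, of ws w0, OF mem] ws by blast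
      moreover have "risk_of v (fst w0) (return borel (snd w0)) \<le> ereal c"
        by (rule risk_of_sublevel_closed[OF v lim(1) weakly_converges_return[OF lim(2)] return_prob return_prob])
          (simp add: g le)
      ultimately show "w0 \<in> {(x, a). a \<in> A s x \<and> g x a \<le> c}"
        by (auto simp: g case_prod_beta)
    qed
  qed (rule that)
  have "optimal_dirac_policy \<gamma> \<sigma> A P C s v (\<lambda>x. return borel (sel x))"
    unfolding optimal_dirac_policy_def
  proof (intro conjI allI)
    show "(\<lambda>x. return borel (sel x)) \<in> borel \<rightarrow>\<^sub>M prob_algebra borel"
      by (rule measurable_compose[OF sel(1) measurable_return_prob_space])
    fix x
    show "\<exists>a. return borel (sel x) = return borel a" by blast
    have "risk_of v x (return borel (sel x)) \<le> risk_of v x \<Lambda>" if "\<Lambda> \<in> probs_on (A s x)" for \<Lambda>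
      by (rule randomization_no_gain[OF v _ that]) (simp add: g sel(3))
    moreover have "return borel (sel x) \<in> probs_on (A s x)"
      by (rule return_probs_on[OF actions_borel sel(2)])
    ultimately show "is_arg_min (\<lambda>\<Lambda>. risk_of v x \<Lambda>) (\<lambda>\<Lambda>. \<Lambda> \<in> probs_on (A s x)) (return borel (sel x))"
      by (auto simp: is_arg_min_def not_less)
  qed
  then show ?thesis by blast
qed

end

end

section \<open>Value functions and the main result\<close>

lemma lower_semicontinuous_uniform_limit:
  assumes u: "\<And>n. lower_semicontinuous (u n)"
    and L: "\<And>n y. \<bar>L y - u n y\<bar> \<le> e n" and e: "e \<longlonglongrightarrow> 0"
  shows "lower_semicontinuous L"
  unfolding lower_semicontinuous_def
proof (intro allI impI)
  fix z c assume c: "c < L z"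
  have "\<forall>\<^sub>F n in sequentially. e n < (L z - c) / 2"
    using c by (intro order_tendstoD(2)[OF e]) simp
  then obtain n where n: "e n < (L z - c) / 2"
    using eventually_happens'[OF sequentially_bot] by blast
  have "c + e n < u n z"
    using n L[of z n] by (simp add: abs_le_iff field_simps)
  then have "\<forall>\<^sub>F w in nhds z. c + e n < u n w"
    using u[of n] unfolding lower_semicontinuous_def by blast
  then show "\<forall>\<^sub>F w in nhds z. c < L w"
  proof eventually_elim
    case (elim w)
    then show ?case using L[of w n] by (simp add: abs_le_iff)
  qed
qed

lemma geometric_increments_converge:
  fixes u :: "nat \<Rightarrow> 'y \<Rightarrow> real"
  assumes incr: "\<And>n y. \<bar>u (Suc n) y - u n y\<bar> \<le> b * q ^ n" and q: "0 \<le> q" "q < 1"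
  obtains L where "\<And>y. (\<lambda>n. u n y) \<longlonglongrightarrow> L y" "\<And>n y. \<bar>L y - u n y\<bar> \<le> b * q ^ n / (1 - q)"
proof -
  define d where "d n y = u (Suc n) y - u n y" for n y
  have geo: "(\<lambda>k. b * q ^ (k + n)) sums (b * q ^ n / (1 - q))" for n
    using sums_mult[OF geometric_sums[of q], of "b * q ^ n"] q by (simp add: power_add ac_simps)
  have summ: "summable (\<lambda>n. d n y)" for y
  proof (rule summable_comparison_test')
    show "summable (\<lambda>n. b * q ^ n)"
      using sums_summable[OF geo[of 0]] by simp
    show "norm (d n y) \<le> b * q ^ n" for n
      using incr by (simp add: d_def)
  qed
  have tele: "(\<Sum>k<n. d k y) = u n y - u 0 y" for n y
    unfolding d_def by (rule sum_lessThan_telescope)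
  define L where "L y = u 0 y + (\<Sum>n. d n y)" for y
  show thesis
  proof
    show "(\<lambda>n. u n y) \<longlonglongrightarrow> L y" for y
      using tendsto_add[OF tendsto_const[of "u 0 y"] summable_LIMSEQ[OF summ[of y]]]
      by (simp add: tele L_def)
    fix n y
    have "L y - u n y = (\<Sum>k. d (k + n) y)"
      using suminf_split_initial_segment[OF summ[of y], of n] by (simp add: tele L_def)
    moreover have "\<bar>\<Sum>k. d (k + n) y\<bar> \<le> (\<Sum>k. b * q ^ (k + n))"
      using norm_suminf_le[of "\<lambda>k. d (k + n) y" "\<lambda>k. b * q ^ (k + n)", OF _ sums_summable[OF geo]] incr
      by (simp add: d_def)
    ultimately show "\<bar>L y - u n y\<bar> \<le> b * q ^ n / (1 - q)"
      using sums_unique[OF geo[of n]] by simp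
  qed
qed

lemma lower_semicontinuous_const: "lower_semicontinuous (\<lambda>_. c)"
  by (simp add: lower_semicontinuous_def)

context
  fixes \<gamma> b :: real
    and \<beta> :: "nat \<Rightarrow> real"
    and \<sigma> :: "'x::polish_space risk"
    and A :: "nat \<Rightarrow> 'x \<Rightarrow> 'a::polish_space set"
    and P :: "('x, 'a) kernel"
    and C :: "('x, 'a) cost"
  assumes stage: "\<And>s. s \<ge> 1 \<Longrightarrow> control_stage \<gamma> b (\<beta> s) \<sigma> A P C s"
begin

abbreviation (input) "J \<equiv> J_opt \<gamma> \<sigma> A P C"

lemma J_opt_eq_optimal_value:
  "1 \<le> s \<Longrightarrow> s \<le> T \<Longrightarrow> J s T = control_stage.optimal_value \<gamma> \<sigma> A P C s (J (s + 1) T)"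
  using control_stage.optimal_value_def[OF stage] by (subst J_opt.simps) auto

lemma J_opt_lsc_bounded:
  assumes "1 \<le> s"
  shows "lower_semicontinuous (J s T) \<and> (\<exists>V. \<forall>y. \<bar>J s T y\<bar> \<le> V)"
  using assms
proof (induction "T + 1 - s" arbitrary: s)
  case 0
  then have "J s T = (\<lambda>x. 0)" by (subst J_opt.simps) auto
  then show ?case by (auto simp: lower_semicontinuous_const)
next
  case (Suc n)
  then have sT: "s \<le> T" by simp
  have IH: "lower_semicontinuous (J (s + 1) T) \<and> (\<exists>V. \<forall>y. \<bar>J (s + 1) T y\<bar> \<le> V)"
    using Suc by (intro Suc.hyps(1)) auto
  then obtain V where v: "lower_semicontinuous (J (s + 1) T)" "\<And>y. \<bar>J (s + 1) T y\<bar> \<le> V" by blast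
  show ?case
    unfolding J_opt_eq_optimal_value[OF Suc.prems sT]
    using control_stage.optimal_value_lsc[OF stage[OF Suc.prems] v]
      control_stage.S_op_bounds(2)[OF stage[OF Suc.prems] v] by blast
qed

text \<open>
  Lengthening the horizon by one step changes the last value function by at most \<open>b\<close>, because the
  normalized risk of a cost bounded by \<open>b\<close> is bounded by \<open>b\<close>; each earlier step contracts the change
  by the factor \<open>\<gamma>\<close>.
\<close>

lemma J_opt_increment:
  assumes normalized: "\<And>s. s \<ge> 1 \<Longrightarrow> control_stage \<gamma> b 0 \<sigma> A P C s" and \<gamma>: "0 \<le> \<gamma>"
    and "1 \<le> s" "s \<le> T + 1"
  shows "\<bar>J s (T + 1) y - J s T y\<bar> \<le> b * \<gamma> ^ (T + 1 - s)"
  using assms(3,4)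
proof (induction "T + 1 - s" arbitrary: s y)
  case 0
  then have s: "s = T + 1" by simp
  have "J (T + 1) T = (\<lambda>x. 0)" "J (T + 1 + 1) (T + 1) = (\<lambda>x. 0)" by (subst J_opt.simps, simp)+
  moreover have "\<bar>control_stage.optimal_value \<gamma> \<sigma> A P C (T + 1) (\<lambda>x. 0) y\<bar> \<le> b + \<gamma> * 0 + 0"
    by (rule control_stage.S_op_bounds(2)[OF normalized lower_semicontinuous_const]) auto
  ultimately show ?case
    using J_opt_eq_optimal_value[of "T + 1" "T + 1"] by (simp add: s)
next
  case (Suc n)
  then have s: "1 \<le> s" "s \<le> T" by auto
  define v where "v = J (s + 1) (T + 1)"
  define w where "w = J (s + 1) T"
  have close: "\<bar>v y - w y\<bar> \<le> b * \<gamma> ^ n" for y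
  proof -
    have n: "n = T + 1 - (s + 1)" using Suc.hyps(2) by simp
    show ?thesis
      using Suc.hyps(1)[OF n, of y] s unfolding n[symmetric] by (simp add: v_def w_def)
  qed
  obtain V W where v: "lower_semicontinuous v" "\<And>y. \<bar>v y\<bar> \<le> V"
    and w: "lower_semicontinuous w" "\<And>y. \<bar>w y\<bar> \<le> W"
    using J_opt_lsc_bounded[of "s + 1"] unfolding v_def w_def by (metis le_add2)
  have "v y \<le> w y + b * \<gamma> ^ n" "w y \<le> v y + b * \<gamma> ^ n" for y
    using close[of y] by (auto simp: abs_le_iff)
  then have "\<bar>control_stage.optimal_value \<gamma> \<sigma> A P C s v y - control_stage.optimal_value \<gamma> \<sigma> A P C s w y\<bar>
      \<le> \<gamma> * (b * \<gamma> ^ n)"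
    using control_stage.optimal_value_shift_mono[OF normalized[OF s(1)] v w, of "b * \<gamma> ^ n" y]
      control_stage.optimal_value_shift_mono[OF normalized[OF s(1)] w v, of "b * \<gamma> ^ n" y]
    by (simp add: abs_le_iff)
  then have "\<bar>J s (T + 1) y - J s T y\<bar> \<le> \<gamma> * (b * \<gamma> ^ n)"
    using J_opt_eq_optimal_value[of s "T + 1"] J_opt_eq_optimal_value[of s T] s
    by (simp add: v_def w_def)
  then show ?case
    using Suc.hyps(2)[symmetric] by (simp add: ac_simps)
qed

lemma J_opt_inf_lsc_bounded:
  assumes normalized: "\<And>s. s \<ge> 1 \<Longrightarrow> control_stage \<gamma> b 0 \<sigma> A P C s"
    and \<gamma>: "0 \<le> \<gamma>" "\<gamma> < 1" and s: "1 \<le> s"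
  shows "lower_semicontinuous (J_opt_inf \<gamma> \<sigma> A P C s) \<and> (\<exists>V. \<forall>y. \<bar>J_opt_inf \<gamma> \<sigma> A P C s y\<bar> \<le> V)"
proof -
  \<comment> \<open>Horizons are counted from \<open>s - 1\<close>, where the value function at \<open>s\<close> is still zero.\<close>
  define u where "u n = J s (n + (s - 1))" for n
  have incr: "\<bar>u (Suc n) y - u n y\<bar> \<le> b * \<gamma> ^ n" for n y
    using J_opt_increment[OF normalized \<gamma>(1) s, of "n + (s - 1)" y] s by (simp add: u_def)
  obtain L where lim: "\<And>y. (\<lambda>n. u n y) \<longlonglongrightarrow> L y"
    and L: "\<And>n y. \<bar>L y - u n y\<bar> \<le> b * \<gamma> ^ n / (1 - \<gamma>)"
    by (rule geometric_increments_converge[of u b \<gamma>, OF incr \<gamma>]) (rule that)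
  have "(\<lambda>T. J s T y) \<longlonglongrightarrow> L y" for y
    using lim[of y] unfolding u_def by (rule LIMSEQ_offset)
  then have J_inf: "J_opt_inf \<gamma> \<sigma> A P C s = L"
    unfolding J_opt_inf_def by (intro ext limI)
  have "(\<lambda>n. \<gamma> ^ n) \<longlonglongrightarrow> 0"
    using \<gamma> by (intro LIMSEQ_power_zero) simp
  then have "(\<lambda>n. b * \<gamma> ^ n / (1 - \<gamma>)) \<longlonglongrightarrow> b * 0 / (1 - \<gamma>)"
    using \<gamma> by (intro tendsto_intros) auto
  then have "lower_semicontinuous L"
    using J_opt_lsc_bounded[OF s] by (intro lower_semicontinuous_uniform_limit[OF _ L]) (auto simp: u_def)
  moreover have "u 0 = (\<lambda>x. 0)"
    unfolding u_def using s by (subst J_opt.simps) auto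
  then have "\<bar>L y\<bar> \<le> b / (1 - \<gamma>)" for y
    using L[of y 0] by simp
  ultimately show ?thesis
    unfolding J_inf by blast
qed

end

theorem proposition6p1:
  fixes \<gamma> b :: real
    and \<beta> :: "nat \<Rightarrow> real"
    and \<sigma> :: "'x::polish_space risk"
    and A :: "nat \<Rightarrow> 'x \<Rightarrow> 'a::polish_space set"
    and P :: "('x, 'a) kernel"
    and C :: "('x, 'a) cost"
    and t :: nat
  assumes gamma: "0 \<le> \<gamma>" "\<gamma> \<le> 1"
    and risk: "\<And>s x. s \<ge> 1 \<Longrightarrow> convex_risk_measure (\<sigma> s x)"
    and risk_measurable: "\<And>s K. s \<ge> 1 \<Longrightarrow> compact K \<Longrightarrow>
          (\<lambda>(x, \<mu>). \<sigma> s x \<mu>) \<in> borel_measurable (borel_of (prod_topology euclidean (weak_topology K)))"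
    and risk_bound: "\<And>s. s \<ge> 1 \<Longrightarrow> \<beta> s \<ge> 0"
          "\<And>s x. s \<ge> 1 \<Longrightarrow> \<bar>\<sigma> s x (return borel 0)\<bar> \<le> ereal (\<beta> s)"
    and actions: "\<And>s x. s \<ge> 1 \<Longrightarrow> A s x \<noteq> {}" "\<And>s x. s \<ge> 1 \<Longrightarrow> closed (A s x)"
          "\<And>s. s \<ge> 1 \<Longrightarrow> weakly_measurable (A s)"
    and kernel: "\<And>s x a. s \<ge> 1 \<Longrightarrow> P s x a \<in> space (prob_algebra borel)"
          "\<And>s B. s \<ge> 1 \<Longrightarrow> B \<in> sets borel \<Longrightarrow>
             (\<lambda>(x, a). measure (P s x a) B) \<in> borel_measurable (borel \<Otimes>\<^sub>M borel)"
    and cost: "\<And>s. s \<ge> 1 \<Longrightarrow>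
          (\<lambda>(x, a, y). C s x a y) \<in> borel_measurable (borel \<Otimes>\<^sub>M borel \<Otimes>\<^sub>M borel)"
    and i: "\<And>s xs x0 as a0 (f :: 'x \<Rightarrow> real). s \<ge> 1 \<Longrightarrow>
          continuous_on UNIV f \<Longrightarrow> bounded (range f) \<Longrightarrow>
          xs \<longlonglongrightarrow> x0 \<Longrightarrow> as \<longlonglongrightarrow> a0 \<Longrightarrow>
          (\<lambda>n. \<integral>y. f y \<partial>P s (xs n) (as n)) \<longlonglongrightarrow> (\<integral>y. f y \<partial>P s x0 a0)"
    and ii: "\<And>s. s \<ge> 1 \<Longrightarrow> compact (\<Union>x. A s x)" "\<And>s. s \<ge> 1 \<Longrightarrow> upper_hemicontinuous (A s)"
    and iii: "\<And>s K \<mu> \<mu>0 xs x0. s \<ge> 1 \<Longrightarrow> compact K \<Longrightarrow>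
          (\<And>n. \<mu> n \<in> probs_on K) \<Longrightarrow> \<mu>0 \<in> probs_on K \<Longrightarrow>
          limitin (weak_topology K) \<mu> \<mu>0 sequentially \<Longrightarrow> xs \<longlonglongrightarrow> x0 \<Longrightarrow>
          liminf (\<lambda>n. \<sigma> s (xs n) (\<mu> n)) \<ge> \<sigma> s x0 \<mu>0"
    and iv: "\<And>s. s \<ge> 1 \<Longrightarrow> lower_semicontinuous (\<lambda>(x, a, y). C s x a y)" "b > 0"
          "\<And>s x a y. s \<ge> 1 \<Longrightarrow> \<bar>C s x a y\<bar> \<le> b"
    and t: "t \<ge> 1"
    and quasiconcave: "\<And>x \<mu>1 \<mu>2 \<theta>. \<mu>1 \<in> bdd_probs \<Longrightarrow> \<mu>2 \<in> bdd_probs \<Longrightarrow> \<theta> \<in> {0..1} \<Longrightarrow>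
          \<sigma> t x (mixture \<theta> \<mu>1 \<mu>2) \<ge> min (\<sigma> t x \<mu>1) (\<sigma> t x \<mu>2)"
  shows "(\<forall>T>t. \<exists>\<pi>. optimal_dirac_policy \<gamma> \<sigma> A P C t (J_opt \<gamma> \<sigma> A P C (t + 1) T) \<pi>) \<and>
         (0 < \<gamma> \<and> \<gamma> < 1 \<and> (\<forall>s\<ge>1. \<forall>x. \<sigma> s x (return borel 0) = 0) \<longrightarrow>
            (\<exists>\<pi>. optimal_dirac_policy \<gamma> \<sigma> A P C t (J_opt_inf \<gamma> \<sigma> A P C (t + 1)) \<pi>))"
proof -
  have weak: "weakly_converges (\<lambda>n. P s (xs n) (as n)) (P s x0 a0)"
    if "s \<ge> 1" "xs \<longlonglongrightarrow> x0" "as \<longlonglongrightarrow> a0" for s xs x0 as a0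
    unfolding weakly_converges_def using i[OF that(1) _ _ that(2,3)] by blast
  have stage: "control_stage \<gamma> b B \<sigma> A P C s"
    if s: "s \<ge> 1" and B: "\<And>x. \<bar>\<sigma> s x (return borel 0)\<bar> \<le> ereal B" for s B
    by (rule control_stage.intro) (fact gamma(1) risk[OF s] B actions(1,2)[OF s] ii[OF s] kernel[OF s] weak[OF s]
        iii[OF s] iv(1)[OF s] iv(3)[OF s])+
  have stage_\<beta>: "control_stage \<gamma> b (\<beta> s) \<sigma> A P C s" if "s \<ge> 1" for s
    by (rule stage[OF that risk_bound(2)[OF that]])
  have policy: "\<exists>\<pi>. optimal_dirac_policy \<gamma> \<sigma> A P C t v \<pi>"
    if "lower_semicontinuous v \<and> (\<exists>V. \<forall>y. \<bar>v y\<bar> \<le> V)" for v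
    using that control_stage.ex_optimal_dirac_policy[OF stage_\<beta>[OF t] quasiconcave] by blast
  show ?thesis
  proof (intro conjI allI impI)
    fix T
    show "\<exists>\<pi>. optimal_dirac_policy \<gamma> \<sigma> A P C t (J_opt \<gamma> \<sigma> A P C (t + 1) T) \<pi>"
      by (intro policy J_opt_lsc_bounded[OF stage_\<beta>]) auto
  next
    assume norm: "0 < \<gamma> \<and> \<gamma> < 1 \<and> (\<forall>s\<ge>1. \<forall>x. \<sigma> s x (return borel 0) = 0)"
    have "control_stage \<gamma> b 0 \<sigma> A P C s" if "s \<ge> 1" for s
      by (rule stage[OF that]) (use norm that in simp)
    then show "\<exists>\<pi>. optimal_dirac_policy \<gamma> \<sigma> A P C t (J_opt_inf \<gamma> \<sigma> A P C (t + 1)) \<pi>"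
      using norm by (intro policy J_opt_inf_lsc_bounded[OF stage_\<beta>]) auto
  qed
qed

end
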